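(* Let $\mathcal{G}_h$ be a rectangular grid of a simply connected polygonal domain $\Omega\subset\mathbb{R}^2$. Then $$\mathrm{curl}_h V_{hs}^{\rm R}=\{\mathbf{z}_h\in \mathbf{V}^{\rm PS}_{h\mathbf n}:\ \mathrm{div}_h\mathbf{z}_h=0\}.$$
   Context: A rectangular grid $\mathcal{G}_h$ of $\Omega$ is a partition of $\Omega$ into axis-parallel rectangles $K$ without hanging nodes. $\mathcal{N}_h^i,\mathcal{N}_h^b$ are the interior and boundary vertices, $\mathcal{E}_h^i,\mathcal{E}_h^b$ the interior and boundary edges, $n_e$ a unit normal of the edge $e$, $\fint_e$ the mean value over $e$, $[\cdot]_e$ the jump across $e$. $P_k(K)$ denotes polynomials of total degree at most $k$. The operators $\mathrm{curl}_h$ and $\mathrm{div}_h$ are the curl, $\mathrm{curl}\,w=(\partial_y w,-\partial_x w)$, and the divergence applied cell by cell. The reduced rectangular Morley space $V_{hs}^{\rm R}$ consists of all $w_h\in L^2(\Omega)$ such that $w_h|_K\in P_2(K)$ for all $K\in\mathcal{G}_h$, $w_h$ is continuous at every $a\in\mathcal{N}_h^i$, $\fint_e\partial_{n_e}w_h\,ds$ is continuous across every $e\in\mathcal{E}_h^i$, and $w_h(a)=0$ for all $a\in\mathcal{N}_h^b$. The Park--Sheen space is $V_h^{\rm PS}=\{w_h\in L^2(\Omega): w_h|_K\in P_1(K)\ \forall K\in\mathcal{G}_h,\ \fint_e[w_h]_e\,ds=0\ \forall e\in\mathcal{E}_h^i\}$, and $\mathbf{V}^{\rm PS}_{h\mathbf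 n}=\{\mathbf{v}_h\in(V_h^{\rm PS})^2:\int_e\mathbf{v}_h\cdot\mathbf{n}\,ds=0\ \forall e\in\mathcal{E}_h^b\}$. *)

theory Defs
  imports "HOL-Analysis.Analysis"
begin

type_synonym point = "real \<times> real"

section \<open>Domain and grid\<close>

text \<open>
  The condition \<open>interior (closure \<Omega>) = \<Omega>\<close> says that the domain lies on one side of each
  piece of its boundary, i.e. it excludes slits and punctures.
\<close>

definition polygonal_domain :: "point set \<Rightarrow> bool" where
  "polygonal_domain \<Omega> \<longleftrightarrow>
     \<Omega> \<noteq> {} \<and> open \<Omega> \<and> connected \<Omega> \<and> bounded \<Omega> \<and> interior (closure \<Omega>) = \<Omega> \<and>
     (\<exists>S. finite S \<and> frontier \<Omega> = (\<Union>(a, b)\<in>S. closed_segment a b))"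

text \<open>
  A member of a division is a closed box, that is, a closed axis-parallel rectangle. The last
  clause excludes hanging nodes: two cells meet in a common face (nothing, a vertex or a whole
  edge of both).
\<close>

definition rectangular_grid :: "point set set \<Rightarrow> point set \<Rightarrow> bool" where
  "rectangular_grid G \<Omega> \<longleftrightarrow>
     G division_of closure \<Omega> \<and>
     (\<forall>K\<in>G. interior K \<noteq> {}) \<and>
     (\<forall>K\<in>G. \<forall>K'\<in>G. K \<inter> K' face_of K \<and> K \<inter> K' face_of K')"

definition vertices :: "point set set \<Rightarrow> point set" where
  "vertices G = {a. \<exists>K\<in>G. a extreme_point_of K}"

definition edges :: "point set set \<Rightarrow> point set set" where
  "edges G = {e. \<exists>K\<in>G. e edge_of K}"

definition interior_vertices :: "point set \<Rightarrow> point set set \<Rightarrow> point set" where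
  "interior_vertices \<Omega> G = {a \<in> vertices G. a \<in> \<Omega>}"

definition boundary_vertices :: "point set \<Rightarrow> point set set \<Rightarrow> point set" where
  "boundary_vertices \<Omega> G = {a \<in> vertices G. a \<in> frontier \<Omega>}"

text \<open>The endpoints of an interior edge may lie on the boundary of the domain.\<close>

definition interior_edges :: "point set \<Rightarrow> point set set \<Rightarrow> point set set" where
  "interior_edges \<Omega> G = {e \<in> edges G. rel_interior e \<subseteq> \<Omega>}"

definition boundary_edges :: "point set \<Rightarrow> point set set \<Rightarrow> point set set" where
  "boundary_edges \<Omega> G = {e \<in> edges G. e \<subseteq> frontier \<Omega>}"

text \<open>
  Edges are used below through their endpoints, \<open>e = closed_segment a b\<close>. Conditions on edges are
  required for both orientations of \<open>e\<close>, hence for both unit normals.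
\<close>

definition unit_normal :: "point \<Rightarrow> point \<Rightarrow> point" where
  "unit_normal a b = (1 / norm (b - a)) *\<^sub>R (snd (b - a), - fst (b - a))"

definition edge_mean :: "point \<Rightarrow> point \<Rightarrow> (point \<Rightarrow> real) \<Rightarrow> real" where
  "edge_mean a b f = integral {0..1} (\<lambda>t. f (linepath a b t))"

definition edge_integral :: "point \<Rightarrow> point \<Rightarrow> (point \<Rightarrow> real) \<Rightarrow> real" where
  "edge_integral a b f = norm (b - a) * edge_mean a b f"

section \<open>Piecewise polynomials\<close>

definition poly_space :: "nat \<Rightarrow> (point \<Rightarrow> real) set" where
  "poly_space k = {p. \<exists>c. \<forall>x y. p (x, y) = (\<Sum>i\<le>k. \<Sum>j\<le>k - i. c i j * x ^ i * y ^ j)}"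

definition square_integrable_on :: "(point \<Rightarrow> real) \<Rightarrow> point set \<Rightarrow> bool" where
  "square_integrable_on f \<Omega> \<longleftrightarrow>
     f \<in> borel_measurable (lebesgue_on \<Omega>) \<and> integrable (lebesgue_on \<Omega>) (\<lambda>x. (f x)\<^sup>2)"

text \<open>
  An element of \<open>L\<^sup>2(\<Omega>)\<close> that is a polynomial on each cell is represented by the unique function of
  its class that equals this polynomial on every open cell and vanishes off the open cells. Thus
  equality of representatives is equality in \<open>L\<^sup>2(\<Omega>)\<close>.
\<close>

definition piecewise_P :: "nat \<Rightarrow> point set \<Rightarrow> point set set \<Rightarrow> (point \<Rightarrow> real) set" where
  "piecewise_P k \<Omega> G =
     {w. square_integrable_on w \<Omega> \<and>
         (\<forall>K\<in>G. \<exists>p\<in>poly_space k. \<forall>x\<in>interior K. w x = p x) \<and>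
         (\<forall>x. x \<notin> (\<Union>K\<in>G. interior K) \<longrightarrow> w x = 0)}"

text \<open>The value at \<open>x \<in> K\<close> of the continuous extension of \<open>f\<close> from the open cell to \<open>K\<close>.\<close>

definition cell_trace :: "point set \<Rightarrow> (point \<Rightarrow> 'a::t2_space) \<Rightarrow> point \<Rightarrow> 'a" where
  "cell_trace K f x = Lim (at x within interior K) f"

definition jump :: "point set \<Rightarrow> point set \<Rightarrow> (point \<Rightarrow> real) \<Rightarrow> point \<Rightarrow> real" where
  "jump K K' f x = cell_trace K f x - cell_trace K' f x"

section \<open>Cellwise differential operators\<close>

definition partial_x :: "(point \<Rightarrow> real) \<Rightarrow> point \<Rightarrow> real" where
  "partial_x f p = deriv (\<lambda>x. f (x, snd p)) (fst p)"

definition partial_y :: "(point \<Rightarrow> real) \<Rightarrow> point \<Rightarrow> real" where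
  "partial_y f p = deriv (\<lambda>y. f (fst p, y)) (snd p)"

definition cellwise :: "point set set \<Rightarrow> (point \<Rightarrow> 'a::zero) \<Rightarrow> point \<Rightarrow> 'a" where
  "cellwise G f x = (if x \<in> (\<Union>K\<in>G. interior K) then f x else 0)"

definition grad_h :: "point set set \<Rightarrow> (point \<Rightarrow> real) \<Rightarrow> point \<Rightarrow> point" where
  "grad_h G w = cellwise G (\<lambda>x. (partial_x w x, partial_y w x))"

definition curl_h :: "point set set \<Rightarrow> (point \<Rightarrow> real) \<Rightarrow> point \<Rightarrow> point" where
  "curl_h G w = cellwise G (\<lambda>x. (partial_y w x, - partial_x w x))"

definition div_h :: "point set set \<Rightarrow> (point \<Rightarrow> point) \<Rightarrow> point \<Rightarrow> real" where
  "div_h G v = cellwise G (\<lambda>x. partial_x (fst \<circ> v) x + partial_y (snd \<circ> v) x)"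

section \<open>Finite element spaces\<close>

text \<open>The reduced rectangular Morley space.\<close>

definition V_hs_R :: "point set \<Rightarrow> point set set \<Rightarrow> (point \<Rightarrow> real) set" where
  "V_hs_R \<Omega> G =
     {w \<in> piecewise_P 2 \<Omega> G.
        (\<forall>a\<in>interior_vertices \<Omega> G. \<forall>K\<in>G. \<forall>K'\<in>G.
           a \<in> K \<and> a \<in> K' \<longrightarrow> cell_trace K w a = cell_trace K' w a) \<and>
        (\<forall>a b. closed_segment a b \<in> interior_edges \<Omega> G \<longrightarrow>
           (\<forall>K\<in>G. \<forall>K'\<in>G. closed_segment a b edge_of K \<and> closed_segment a b edge_of K' \<longrightarrow>
              edge_mean a b (cell_trace K (\<lambda>x. grad_h G w x \<bullet> unit_normal a b)) =
              edge_mean a b (cell_trace K' (\<lambda>x. grad_h G w x \<bullet> unit_normal a b)))) \<and>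
        (\<forall>a\<in>boundary_vertices \<Omega> G. \<forall>K\<in>G. a \<in> K \<longrightarrow> cell_trace K w a = 0)}"

text \<open>The Park--Sheen space.\<close>

definition V_PS :: "point set \<Rightarrow> point set set \<Rightarrow> (point \<Rightarrow> real) set" where
  "V_PS \<Omega> G =
     {w \<in> piecewise_P 1 \<Omega> G.
        \<forall>a b. closed_segment a b \<in> interior_edges \<Omega> G \<longrightarrow>
          (\<forall>K\<in>G. \<forall>K'\<in>G. closed_segment a b edge_of K \<and> closed_segment a b edge_of K' \<longrightarrow>
             edge_mean a b (jump K K' w) = 0)}"

definition V_PS_hn :: "point set \<Rightarrow> point set set \<Rightarrow> (point \<Rightarrow> point) set" where
  "V_PS_hn \<Omega> G =
     {v. fst \<circ> v \<in> V_PS \<Omega> G \<and> snd \<circ> v \<in> V_PS \<Omega> G \<and>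
        (\<forall>a b. closed_segment a b \<in> boundary_edges \<Omega> G \<longrightarrow>
          (\<forall>K\<in>G. closed_segment a b edge_of K \<longrightarrow>
             edge_integral a b (cell_trace K (\<lambda>x. v x \<bullet> unit_normal a b)) = 0))}"

end

theory Submission
  imports Defs "HOL-Complex_Analysis.Riemann_Mapping"
begin

text \<open>
  For a quadratic \<open>w\<close>, the mean of \<open>\<nabla>w\<close> over a segment is its value at the midpoint \<open>m\<close>, and
  \<open>w b - w a = \<nabla>w m \<bullet> (b - a)\<close>. So continuity at the endpoints together with continuity of the mean
  normal derivative says precisely that the mean of the whole gradient is continuous, which gives
  one inclusion.

  Conversely, a solenoidal Park--Sheen field with vanishing normal means on the boundary extends by
  zero to the whole plane: its normal edge means match across every edge. Hence it has a global
  stream function, which can be written down. On a cell \<open>K\<close> its bilinear vertex interpolant has the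
  constant mixed derivative \<open>\<beta>\<^sub>K = \<partial>\<^sub>x z\<^sub>1 = - \<partial>\<^sub>y z\<^sub>2\<close>, so that
  \<open>\<Psi>(x, y) = \<Sum>\<^sub>K \<beta>\<^sub>K \<bar>K \<inter> {..x} \<times> {..y}\<bar>\<close>. It is continuous and constant on each boundary edge.
  Simple connectedness enters only through the connectedness of the frontier, by which \<open>\<Psi>\<close> is
  constant there. The cellwise quadratic potentials are then adjusted by constants to take the
  values of \<open>\<Psi>\<close> at the vertices.
\<close>

section \<open>Connectedness of the frontier\<close>

text \<open>The frontier criterion for simply connected open sets is stated in the complex plane.
  The set is carried there by the coordinate homeomorphism \<open>h\<close>, which preserves
  closures and hence frontiers; for a bounded set the criterion yields a connected frontier.\<close>

lemma connected_frontier_simply_connected: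
  fixes S :: "(real \<times> real) set"
  assumes "open S" "bounded S" "simply_connected S"
  shows "connected (frontier S)"
proof -
  define h :: "real \<times> real \<Rightarrow> complex" where "h = (\<lambda>p. Complex (fst p) (snd p))"
  define k :: "complex \<Rightarrow> real \<times> real" where "k = (\<lambda>z. (Re z, Im z))"
  have kh: "k (h p) = p" and hk: "h (k z) = z" for p z
    by (auto simp: h_def k_def)
  have k_h: "k ` h ` A = A" for A
    by (simp only: image_image kh image_ident)
  have h_cont: "continuous_on A h" and k_cont: "continuous_on B k" for A B
    by (auto simp: h_def k_def intro!: continuous_intros continuous_on_Complex)
  have im: "h ` A = k -` A" for A
    by (auto simp: image_iff kh) (metis hk)
  have open_hS: "open (h ` S)"
    unfolding im using open_vimage[OF assms(1)] k_cont by blast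
  have h_closure: "h ` closure S \<subseteq> closure (h ` S)"
    by (rule image_closure_subset[OF h_cont]) (auto simp: closure_subset)
  have "k ` closure (h ` S) \<subseteq> closure S"
    by (rule image_closure_subset[OF k_cont]) (simp_all only: k_h closure_subset closed_closure)
  then have "closure (h ` S) \<subseteq> h ` closure S"
    unfolding im by auto
  with h_closure have "closure (h ` S) = h ` closure S"
    by auto
  moreover have "inj h"
    by (metis injI kh)
  ultimately have "h ` frontier S = frontier (h ` S)"
    using open_hS assms(1) by (simp add: frontier_def interior_open image_set_diff)
  moreover have "connected (frontier (h ` S))"
  proof -
    have "S homeomorphic (h ` S)"
      by (rule homeomorphicI[OF refl k_h h_cont k_cont kh hk])
    then have "simply_connected (h ` S)"
      by (rule homeomorphic_simply_connected[OF _ assms(3)])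
    moreover have "bounded (h ` S)"
    proof -
      have "bounded (h ` closure S)"
        by (intro compact_imp_bounded compact_continuous_image h_cont)
           (simp add: assms(2) compact_closure)
      then show ?thesis
        by (rule bounded_subset[OF _ image_mono[OF closure_subset]])
    qed
    ultimately show ?thesis
      by (simp add: simply_connected_eq_frontier_properties[OF open_hS])
  qed
  ultimately have "connected (k ` h ` frontier S)"
    by (metis connected_continuous_image k_cont)
  then show ?thesis
    by (simp only: k_h)
qed

section \<open>The stream function of a family of rectangles\<close>

text \<open>The length of \<open>{a..b} \<inter> {..x}\<close>.\<close>

definition clamp_length :: "real \<Rightarrow> real \<Rightarrow> real \<Rightarrow> real" where
  "clamp_length a b x = min (max (x - a) 0) (b - a)"

text \<open>\<open>clamp_length a b\<close> is an antiderivative of the indicator of the open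
  interval: up to the points \<open>a\<close> and \<open>b\<close>, the integrand is the indicator
  of the possibly empty interval \<open>{max a s..min b t}\<close>.\<close>

lemma has_integral_clamp_length:
  assumes "a < b" "s \<le> t"
  shows "((\<lambda>x. if a < x \<and> x < b then 1 else 0::real) has_integral (clamp_length a b t - clamp_length a b s)) {s..t}"
proof -
  have "((\<lambda>x. 1::real) has_integral measure lborel {max a s..min b t}) {max a s..min b t}"
    using has_integral_const_real[of "1::real" "max a s" "min b t"] by simp
  then have "((\<lambda>x. if x \<in> {max a s..min b t} then 1 else 0::real) has_integral measure lborel {max a s..min b t}) {s..t}"
    by (subst has_integral_restrict) auto
  moreover have "measure lborel {max a s..min b t} = clamp_length a b t - clamp_length a b s"
    using assms by (auto simp: clamp_length_def min_def max_def content_real_if)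
  ultimately have "((\<lambda>x. if x \<in> {max a s..min b t} then 1 else 0::real) has_integral (clamp_length a b t - clamp_length a b s)) {s..t}"
    by simp
  then show ?thesis
    by (rule has_integral_spike_finite[of "{a, b}", rotated 2]) auto
qed

text \<open>
  \<open>L\<close> and \<open>R\<close> stand for the mean fluxes through the left and the right side of a rectangle; a
  nonzero flux is passed on to the neighbour.
\<close>

locale cell_family =
  fixes I :: "'i set" and a b c d \<beta> L R :: "'i \<Rightarrow> real"
  assumes finite_I: "finite I"
    and ab: "\<And>K. K \<in> I \<Longrightarrow> a K < b K" and cd: "\<And>K. K \<in> I \<Longrightarrow> c K < d K"
    and disjoint: "\<And>K K'. \<lbrakk>K \<in> I; K' \<in> I; K \<noteq> K'\<rbrakk> \<Longrightarrow>
       b K \<le> a K' \<or> b K' \<le> a K \<or> d K \<le> c K' \<or> d K' \<le> c K"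
    and slope: "\<And>K. K \<in> I \<Longrightarrow> \<beta> K * (b K - a K) = R K - L K"
    and right: "\<And>K. \<lbrakk>K \<in> I; R K \<noteq> 0\<rbrakk> \<Longrightarrow>
       \<exists>K'\<in>I. a K' = b K \<and> c K' = c K \<and> d K' = d K \<and> L K' = R K"
    and left: "\<And>K. \<lbrakk>K \<in> I; L K \<noteq> 0\<rbrakk> \<Longrightarrow>
       \<exists>K'\<in>I. b K' = a K \<and> c K' = c K \<and> d K' = d K \<and> R K' = L K"
begin

definition potential :: "real \<Rightarrow> real \<Rightarrow> real" where
  "potential x y = (\<Sum>K\<in>I. \<beta> K * clamp_length (a K) (b K) x * clamp_length (c K) (d K) y)"

text \<open>
  Along the line at height \<open>t\<close> the increments \<open>R - L\<close> telescope, since every nonzero \<open>R\<close> is the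
  \<open>L\<close> of the next rectangle.
\<close>

lemma row_sum:
  assumes K0: "K0 \<in> I" and t: "c K0 < t" "t < d K0"
  defines "J \<equiv> {K\<in>I. c K < t \<and> t < d K}"
  shows "(\<Sum>K\<in>J. \<beta> K * clamp_length (a K) (b K) (a K0)) = L K0" (is ?left)
    and "(\<Sum>K\<in>J. \<beta> K * clamp_length (a K) (b K) (b K0)) = R K0" (is ?right)
proof -
  \<comment> \<open>The part of the row to the left of \<open>K0\<close>, whose increments will sum
    to \<open>L K0\<close>.\<close>
  define S where "S = {K\<in>J. b K \<le> a K0}"
  have J: "finite J" "K0 \<in> J" "J \<subseteq> I"
    using K0 t finite_I by (auto simp: J_def)
  have sep: "b K \<le> a K' \<or> b K' \<le> a K" if "K \<in> J" "K' \<in> J" "K \<noteq> K'" for K K'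
    using disjoint[of K K'] that by (auto simp: J_def)
  have K0S: "K0 \<notin> S"
    using ab[OF K0] by (auto simp: S_def)
  have finS: "finite S"
    using J by (auto simp: S_def)
  have off: "b K \<le> a K0 \<or> b K0 \<le> a K" if "K \<in> J" "K \<noteq> K0" for K
    using sep[of K K0] that J by auto
  \<comment> \<open>Only nonzero fluxes have a guaranteed neighbour. Dropping the zero ones makes
    passage to the right neighbour a bijection from \<open>S'\<close> to \<open>T'\<close>.\<close>
  define S' where "S' = {K\<in>S. R K \<noteq> 0}"
  define T' where "T' = {K\<in>insert K0 S. L K \<noteq> 0}"
  have sub: "S' \<subseteq> J" "T' \<subseteq> J"
    using J by (auto simp: S'_def T'_def S_def)
  have uniq_a: "K = K'" if "K \<in> J" "K' \<in> J" "a K = a K'" for K K'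
    using sep[of K K'] that ab[of K] ab[of K'] J by force
  have uniq_b: "K = K'" if "K \<in> J" "K' \<in> J" "b K = b K'" for K K'
    using sep[of K K'] that ab[of K] ab[of K'] J by force
  have to_right: "\<exists>K'\<in>T'. a K' = b K \<and> L K' = R K" if "K \<in> S'" for K
  proof -
    have "K \<in> I" "R K \<noteq> 0" using that sub J by (auto simp: S'_def)
    from right[OF this] obtain K' where K': "K' \<in> I" "a K' = b K" "c K' = c K" "d K' = d K" "L K' = R K"
      by blast
    moreover have "K' \<in> J"
      using K' that by (auto simp: S'_def S_def J_def)
    \<comment> \<open>\<open>K'\<close> starts at or before the left end of \<open>K0\<close>, so it
      cannot lie to the right of \<open>K0\<close>.\<close>
    moreover have "K' = K0 \<or> b K' \<le> a K0"
      using off[of K'] \<open>K' \<in> J\<close> K' that ab[OF K0] by (auto simp: S'_def S_def)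
    ultimately show ?thesis
      using that by (auto simp: S'_def T'_def S_def)
  qed
  have to_left: "\<exists>K'\<in>S'. b K' = a K" if "K \<in> T'" for K
  proof -
    have "K \<in> J" using that sub by auto
    then have "K \<in> I" "L K \<noteq> 0" using that J by (auto simp: T'_def)
    from left[OF this] obtain K' where K': "K' \<in> I" "b K' = a K" "c K' = c K" "d K' = d K" "R K' = L K"
      by blast
    have "a K \<le> a K0"
      using that ab[of K] \<open>K \<in> J\<close> J by (auto simp: T'_def S_def)
    then show ?thesis
      using K' \<open>K \<in> J\<close> that by (auto simp: S_def S'_def T'_def J_def)
  qed
  obtain j where j: "\<And>K. K \<in> S' \<Longrightarrow> j K \<in> T' \<and> a (j K) = b K \<and> L (j K) = R K"
    using to_right by metis
  have "(\<Sum>K\<in>S. R K) = (\<Sum>K\<in>S'. R K)"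
    using finS by (intro sum.mono_neutral_right) (auto simp: S'_def)
  also have "\<dots> = (\<Sum>K\<in>T'. L K)"
  proof (rule sum.reindex_cong[symmetric, of j])
    show "inj_on j S'"
      using j sub uniq_b by (intro inj_onI) (metis subsetD)
    show "T' = j ` S'"
    proof (intro equalityI subsetI)
      fix K assume K: "K \<in> T'"
      then obtain K' where K': "K' \<in> S'" "b K' = a K" using to_left by blast
      then have "j K' = K"
        using j[OF K'(1)] K sub by (intro uniq_a) auto
      then show "K \<in> j ` S'" using K' by blast
    qed (use j in auto)
  qed (use j in auto)
  also have "\<dots> = (\<Sum>K\<in>insert K0 S. L K)"
    using finS by (intro sum.mono_neutral_left) (auto simp: T'_def)
  finally have "(\<Sum>K\<in>S. R K) = (\<Sum>K\<in>insert K0 S. L K)" .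
  then have RL: "(\<Sum>K\<in>S. R K - L K) = L K0"
    using finS K0S by (simp add: sum_subtractf)
  \<comment> \<open>A rectangle that does not straddle \<open>x\<close> is counted with its full
    width or not at all; in the first case \<open>slope\<close> gives its increment.\<close>
  have contrib: "\<beta> K * clamp_length (a K) (b K) x = (if b K \<le> x then R K - L K else 0)"
    if "K \<in> J" "b K \<le> x \<or> x \<le> a K" for K x
    using that ab[of K] slope[of K] J by (auto simp: clamp_length_def min_def max_def)
  have "(\<Sum>K\<in>J. \<beta> K * clamp_length (a K) (b K) (a K0)) = (\<Sum>K\<in>J. if b K \<le> a K0 then R K - L K else 0)"
    using off ab[OF K0] by (intro sum.cong refl contrib) force+
  also have "\<dots> = (\<Sum>K\<in>S. R K - L K)"
    unfolding S_def using J by (subst sum.inter_filter) auto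
  finally show ?left using RL by simp
  have "(\<Sum>K\<in>J. \<beta> K * clamp_length (a K) (b K) (b K0)) = (\<Sum>K\<in>J. if b K \<le> b K0 then R K - L K else 0)"
    using off ab[OF K0] by (intro sum.cong refl contrib) force+
  also have "\<dots> = (\<Sum>K\<in>{K\<in>J. b K \<le> b K0}. R K - L K)"
    using J by (subst sum.inter_filter) auto
  \<comment> \<open>Moving to the right end of \<open>K0\<close> adds only \<open>K0\<close> itself,
    hence the increment \<open>R K0 - L K0\<close>.\<close>
  also have "{K\<in>J. b K \<le> b K0} = insert K0 S"
  proof -
    have "b K \<le> a K0" if "K \<in> J" "K \<noteq> K0" "b K \<le> b K0" for K
      using off[OF that(1,2)] that ab[of K] J by fastforce
    then show ?thesis
      using ab[OF K0] J by (auto simp: S_def)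
  qed
  finally show ?right using RL finS K0S by simp
qed

text \<open>
  The rectangles met at height \<open>t\<close> may change between \<open>c K0\<close> and \<open>d K0\<close>, hence the integration
  of the row sums over \<open>t\<close>.
\<close>

lemma potential_diff:
  assumes K0: "K0 \<in> I" and y: "c K0 \<le> y" "y \<le> d K0"
  shows "potential (a K0) y - potential (a K0) (c K0) = (y - c K0) * L K0"
    and "potential (b K0) y - potential (b K0) (c K0) = (y - c K0) * R K0"
proof -
  have main: "potential x y - potential x (c K0) = (y - c K0) * M"
    if M: "\<And>t. \<lbrakk>c K0 < t; t < d K0\<rbrakk> \<Longrightarrow> (\<Sum>K\<in>{K\<in>I. c K < t \<and> t < d K}. \<beta> K * clamp_length (a K) (b K) x) = M" for x M
  proof -
    \<comment> \<open>The integral of the row sums over \<open>t\<close> is evaluated twice: term by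
      term, which produces clamped lengths, and as the integral of the constant
      \<open>M\<close>.\<close>
    have "((\<lambda>t. \<Sum>K\<in>I. \<beta> K * clamp_length (a K) (b K) x * (if c K < t \<and> t < d K then 1 else 0)) has_integral
        (\<Sum>K\<in>I. \<beta> K * clamp_length (a K) (b K) x * (clamp_length (c K) (d K) y - clamp_length (c K) (d K) (c K0)))) {c K0..y}"
      by (intro has_integral_sum finite_I has_integral_mult_right has_integral_clamp_length cd y)
    moreover have "((\<lambda>t. \<Sum>K\<in>I. \<beta> K * clamp_length (a K) (b K) x * (if c K < t \<and> t < d K then 1 else 0)) has_integral
        (y - c K0) * M) {c K0..y}"
    proof (rule has_integral_spike_finite[of "{c K0, y}" _ _ "\<lambda>t. M"])
      show "((\<lambda>t. M) has_integral (y - c K0) * M) {c K0..y}"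
        using has_integral_const_real[of M "c K0" y] y by simp
      fix t assume "t \<in> {c K0..y} - {c K0, y}"
      then have t: "c K0 < t" "t < d K0" using y by auto
      have "(\<Sum>K\<in>I. \<beta> K * clamp_length (a K) (b K) x * (if c K < t \<and> t < d K then 1 else 0)) =
          (\<Sum>K\<in>I. if c K < t \<and> t < d K then \<beta> K * clamp_length (a K) (b K) x else 0)"
        by (intro sum.cong) auto
      also have "\<dots> = M"
        using M[OF t] finite_I by (subst (asm) sum.inter_filter) auto
      finally show "(\<Sum>K\<in>I. \<beta> K * clamp_length (a K) (b K) x * (if c K < t \<and> t < d K then 1 else 0)) = M" .
    qed auto
    ultimately have "(\<Sum>K\<in>I. \<beta> K * clamp_length (a K) (b K) x * (clamp_length (c K) (d K) y - clamp_length (c K) (d K) (c K0))) = (y - c K0) * M"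
      by (rule has_integral_unique)
    then show ?thesis
      unfolding potential_def by (simp add: sum_subtractf algebra_simps)
  qed
  show "potential (a K0) y - potential (a K0) (c K0) = (y - c K0) * L K0"
    and "potential (b K0) y - potential (b K0) (c K0) = (y - c K0) * R K0"
    by (rule main; rule row_sum[OF K0]; assumption)+
qed

end

section \<open>Faces of rectangles\<close>

lemma closed_segment_vertical:
  fixes x c d :: real
  shows "closed_segment (x, c) (x, d) = {x} \<times> closed_segment c d"
  by (auto simp: in_segment algebra_simps)

lemma closed_segment_horizontal:
  fixes y a b :: real
  shows "closed_segment (a, y) (b, y) = closed_segment a b \<times> {y}"
  by (auto simp: in_segment algebra_simps)

text \<open>A proper face misses the open interval, and convexity prevents it from consisting of
  both endpoints.\<close>

lemma face_of_atLeastAtMost_real: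
  fixes a b :: real
  assumes "a < b"
  shows "F face_of {a..b} \<longleftrightarrow> F = {} \<or> F = {a} \<or> F = {b} \<or> F = {a..b}"
proof
  assume F: "F face_of {a..b}"
  show "F = {} \<or> F = {a} \<or> F = {b} \<or> F = {a..b}"
  proof (cases "F = {a..b}")
    case False
    then have "F \<inter> {a<..<b} = {}"
      using face_of_disjoint_interior[OF F] by simp
    moreover have "F \<subseteq> {a..b}"
      using F face_of_imp_subset by blast
    ultimately have sub: "F \<subseteq> {a, b}"
      by force
    moreover have "F \<noteq> {a, b}"
    proof
      assume "F = {a, b}"
      then have "closed_segment a b \<subseteq> F"
        using face_of_imp_convex[OF F] by (simp add: convex_contains_segment)
      then have "(a + b) / 2 \<in> F"
        using assms by (auto simp: closed_segment_eq_real_ivl)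
      then show False
        using sub assms by auto
    qed
    ultimately show ?thesis by blast
  qed simp
next
  have "{x} face_of {a..b}" if "x = a \<or> x = b" for x
    using that assms extreme_point_of_segment[of x a b]
    by (simp add: face_of_singleton closed_segment_eq_real_ivl)
  then show "F = {} \<or> F = {a} \<or> F = {b} \<or> F = {a..b} \<Longrightarrow> F face_of {a..b}"
    by (auto simp: face_of_refl)
qed

lemma aff_dim_rectangle:
  fixes a b c d :: real
  shows "c < d \<Longrightarrow> aff_dim ({a} \<times> {c..d}) = 1"
    and "a < b \<Longrightarrow> aff_dim ({a..b} \<times> {c}) = 1"
    and "a < b \<Longrightarrow> c < d \<Longrightarrow> aff_dim ({a..b} \<times> {c..d}) = 2"
proof -
  have seg: "aff_dim (closed_segment p q) = (if p = q then 0 else 1)" for p q :: point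
    by (simp add: segment_convex_hull aff_dim_convex_hull)
  show "c < d \<Longrightarrow> aff_dim ({a} \<times> {c..d}) = 1"
    using seg[of "(a, c)" "(a, d)"] by (simp add: closed_segment_vertical closed_segment_eq_real_ivl)
  show "a < b \<Longrightarrow> aff_dim ({a..b} \<times> {c}) = 1"
    using seg[of "(a, c)" "(b, c)"] by (simp add: closed_segment_horizontal closed_segment_eq_real_ivl)
  show "a < b \<Longrightarrow> c < d \<Longrightarrow> aff_dim ({a..b} \<times> {c..d}) = 2"
    by (subst aff_dim_nonempty_interior) (auto simp: interior_Times)
qed

text \<open>Faces of a product are products of faces. Dimension 1 leaves a point in one factor and
  the whole interval in the other.\<close>

lemma edge_of_rectangle:
  fixes a b c d :: real
  assumes "a < b" "c < d"
  shows "e edge_of {a..b} \<times> {c..d} \<longleftrightarrow>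
    e = {a} \<times> {c..d} \<or> e = {b} \<times> {c..d} \<or> e = {a..b} \<times> {c} \<or> e = {a..b} \<times> {d}"
proof
  assume "e edge_of {a..b} \<times> {c..d}"
  then obtain F F' where e: "e = F \<times> F'" "F face_of {a..b}" "F' face_of {c..d}" and dim: "aff_dim e = 1"
    by (auto simp: edge_of_def face_of_Times_decomp)
  have "aff_dim {(x, y)} = 0" for x y :: real
    by (rule aff_dim_sing)
  then show "e = {a} \<times> {c..d} \<or> e = {b} \<times> {c..d} \<or> e = {a..b} \<times> {c} \<or> e = {a..b} \<times> {d}"
    using e dim aff_dim_rectangle(3)[OF assms] unfolding face_of_atLeastAtMost_real[OF assms(1)]
      face_of_atLeastAtMost_real[OF assms(2)] by (elim disjE) simp_all
next
  have "{a} \<times> {c..d} face_of {a..b} \<times> {c..d}" "{b} \<times> {c..d} face_of {a..b} \<times> {c..d}"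
    "{a..b} \<times> {c} face_of {a..b} \<times> {c..d}" "{a..b} \<times> {d} face_of {a..b} \<times> {c..d}"
    using assms by (simp_all add: face_of_Times face_of_atLeastAtMost_real)
  then show "e = {a} \<times> {c..d} \<or> e = {b} \<times> {c..d} \<or> e = {a..b} \<times> {c} \<or> e = {a..b} \<times> {d} \<Longrightarrow>
    e edge_of {a..b} \<times> {c..d}"
    using assms by (auto simp: edge_of_def aff_dim_rectangle)
qed

text \<open>An extreme point is a singleton face, so it splits into singleton faces of the two
  intervals.\<close>

lemma extreme_point_of_rectangle:
  fixes a b c d :: real
  assumes "a < b" "c < d"
  shows "p extreme_point_of {a..b} \<times> {c..d} \<longleftrightarrow> p \<in> {a, b} \<times> {c, d}"
proof -
  obtain x y where p: "p = (x, y)" by fastforce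
  have "{p} = {x} \<times> {y}" by (simp add: p)
  then have 1: "p extreme_point_of {a..b} \<times> {c..d} \<longleftrightarrow> {x} face_of {a..b} \<and> {y} face_of {c..d}"
    using face_of_Times_eq[of "{x}" "{y}"] by (simp flip: face_of_singleton)
  have singleton_Icc: "{z} = {u..v} \<longleftrightarrow> z = u \<and> z = v" for z u v :: real
    by (metis Icc_eq_Icc atLeastAtMost_singleton order_refl)
  have "{x} face_of {a..b} \<and> {y} face_of {c..d} \<longleftrightarrow> p \<in> {a, b} \<times> {c, d}"
    using assms unfolding p face_of_atLeastAtMost_real[OF assms(1)] face_of_atLeastAtMost_real[OF assms(2)]
    by (auto simp: singleton_Icc)
  with 1 show ?thesis by simp
qed

lemma rel_interior_rectangle:
  fixes a b c d :: real
  shows "c < d \<Longrightarrow> rel_interior ({a} \<times> {c..d}) = {a} \<times> {c<..<d}"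
    and "a < b \<Longrightarrow> rel_interior ({a..b} \<times> {c}) = {a<..<b} \<times> {c}"
  by (simp_all add: rel_interior_Times rel_interior_real_box)

section \<open>Geometry of the grid\<close>

text \<open>The coordinates are read off from the set itself, so that they can serve as the
  functions \<open>a\<close>, \<open>b\<close>, \<open>c\<close>, \<open>d\<close> of
  \<open>cell_family\<close>.\<close>

definition x_lo :: "point set \<Rightarrow> real" where "x_lo K = fst (interval_lowerbound K)"
definition x_hi :: "point set \<Rightarrow> real" where "x_hi K = fst (interval_upperbound K)"
definition y_lo :: "point set \<Rightarrow> real" where "y_lo K = snd (interval_lowerbound K)"
definition y_hi :: "point set \<Rightarrow> real" where "y_hi K = snd (interval_upperbound K)"

section \<open>Cells in coordinates\<close>

locale domain_grid =
  fixes \<Omega> :: "point set" and G :: "point set set"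
  assumes domain: "polygonal_domain \<Omega>" and grid: "rectangular_grid G \<Omega>"
begin

lemma open_domain: "open \<Omega>" and bounded_domain: "bounded \<Omega>"
  and interior_closure_domain: "interior (closure \<Omega>) = \<Omega>"
  using domain by (auto simp: polygonal_domain_def)

lemma division: "G division_of closure \<Omega>"
  using grid by (simp add: rectangular_grid_def)

lemmas finite_grid = division_ofD(1)[OF division]
  and interiors_disjoint = division_ofD(5)[OF division]
  and Union_grid = division_ofD(6)[OF division]

lemma face_Int: "K \<in> G \<Longrightarrow> K' \<in> G \<Longrightarrow> K \<inter> K' face_of K"
  using grid unfolding rectangular_grid_def by blast

lemma cell_bounds:
  assumes "K \<in> G"
  shows "x_lo K < x_hi K" "y_lo K < y_hi K"
    and cell_eq: "K = {x_lo K..x_hi K} \<times> {y_lo K..y_hi K}"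
proof -
  have "interior K \<noteq> {}"
    using grid assms unfolding rectangular_grid_def by blast
  moreover obtain p q where "K = cbox p q"
    using division_ofD(4)[OF division assms] by blast
  moreover obtain a c b d where "p = (a, c)" "q = (b, d)"
    by (metis surj_pair)
  ultimately have K: "K = {a..b} \<times> {c..d}" and "a < b" "c < d"
    by (auto simp: cbox_Pair_eq interior_Times)
  have "interval_lowerbound K = (a, c)" "interval_upperbound K = (b, d)"
    using interval_lowerbound_Times[of "{a..b}" "{c..d}"] interval_upperbound_Times[of "{a..b}" "{c..d}"]
      interval_lowerbound[of a b] interval_upperbound[of a b] interval_lowerbound[of c d] interval_upperbound[of c d]
      \<open>a < b\<close> \<open>c < d\<close> by (simp_all add: K)
  then show "x_lo K < x_hi K" "y_lo K < y_hi K" "K = {x_lo K..x_hi K} \<times> {y_lo K..y_hi K}"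
    using \<open>a < b\<close> \<open>c < d\<close> K by (simp_all add: x_lo_def x_hi_def y_lo_def y_hi_def)
qed

lemma interior_cell:
  assumes "K \<in> G"
  shows "interior K = {x_lo K<..<x_hi K} \<times> {y_lo K<..<y_hi K}"
  by (subst cell_eq[OF assms]) (simp add: interior_Times)

lemma edge_of_cell:
  assumes "K \<in> G"
  shows "e edge_of K \<longleftrightarrow> e = {x_lo K} \<times> {y_lo K..y_hi K} \<or> e = {x_hi K} \<times> {y_lo K..y_hi K} \<or>
    e = {x_lo K..x_hi K} \<times> {y_lo K} \<or> e = {x_lo K..x_hi K} \<times> {y_hi K}"
  using edge_of_rectangle[OF cell_bounds(1,2)[OF assms], of e] cell_eq[OF assms] by simp

text \<open>Otherwise the coordinate ranges overlap with positive length in both directions, and the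
  centre of the overlap is interior to both cells.\<close>

lemma cells_separated:
  assumes "K \<in> G" "K' \<in> G" "K \<noteq> K'"
  shows "x_hi K \<le> x_lo K' \<or> x_hi K' \<le> x_lo K \<or> y_hi K \<le> y_lo K' \<or> y_hi K' \<le> y_lo K"
proof (rule ccontr)
  assume not: "\<not> ?thesis"
  define x y where "x = (max (x_lo K) (x_lo K') + min (x_hi K) (x_hi K')) / 2"
    and "y = (max (y_lo K) (y_lo K') + min (y_hi K) (y_hi K')) / 2"
  have "(x, y) \<in> interior K \<inter> interior K'"
    using not cell_bounds(1,2)[OF assms(1)] cell_bounds(1,2)[OF assms(2)]
    by (auto simp: interior_cell assms x_def y_def max_def min_def field_simps)
  then show False
    using interiors_disjoint[OF assms] by blast
qed

section \<open>Edges and the cells that share them\<close>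

lemma edge_Int_interior:
  assumes "K \<in> G" "e edge_of K"
  shows "e \<inter> interior K = {}"
proof -
  \<comment> \<open>An edge has dimension 1 and a cell dimension 2, so an edge is a proper
    face.\<close>
  have "e \<noteq> K"
    using assms cell_eq[of K] aff_dim_rectangle(3)[OF cell_bounds(1,2)[of K]] by (auto simp: edge_of_def)
  then show ?thesis
    using assms face_of_disjoint_interior by (auto simp: edge_of_def)
qed

text \<open>The intersection of the cells is a face of both. It contains \<open>e\<close> because it
  meets the relative interior of \<open>e\<close>, and it is a proper face because the interiors are
  disjoint. So its dimension is at most 1, which forces equality with \<open>e\<close>.\<close>

lemma shared_edge:
  assumes K: "K \<in> G" "K' \<in> G" "K \<noteq> K'" and e: "e edge_of K" and p: "p \<in> rel_interior e" "p \<in> K'"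
  shows "e edge_of K'"
proof -
  have F: "K \<inter> K' face_of K" "K \<inter> K' face_of K'"
    using face_Int[of K K'] face_Int[of K' K] K by (auto simp: Int_commute)
  have conv: "convex K"
    using cell_eq[OF K(1)] by (metis convex_Times convex_real_interval(5))
  have eK: "e face_of K" "aff_dim e = 1" "e \<subseteq> K"
    using e by (auto simp: edge_of_def face_of_imp_subset)
  have "e \<subseteq> K \<inter> K'"
    using subset_of_face_of[OF F(1) \<open>e \<subseteq> K\<close>] p rel_interior_subset eK by blast
  then have e_face: "e face_of K \<inter> K'"
    using face_of_subset[OF eK(1)] by blast
  have "K \<inter> K' \<noteq> K"
  proof
    assume "K \<inter> K' = K"
    then have "interior K \<subseteq> interior K'"
      by (metis inf.cobounded2 interior_mono)
    then show False
      using interiors_disjoint[OF K] cell_bounds(1,2)[OF K(1)] unfolding interior_cell[OF K(1)]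
      by (simp add: inf.absorb1)
  qed
  then have "aff_dim (K \<inter> K') < aff_dim K"
    using face_of_aff_dim_lt[OF conv F(1)] by blast
  also have "aff_dim K = 2"
    using aff_dim_rectangle(3)[OF cell_bounds(1,2)[OF K(1)]] cell_eq[OF K(1)] by simp
  finally have "aff_dim (K \<inter> K') \<le> aff_dim e"
    using eK by simp
  then have "e = K \<inter> K'"
    using face_of_aff_dim_lt[OF face_of_imp_convex[OF F(1)] e_face] by force
  then show ?thesis
    using F(2) eK(2) by (simp add: edge_of_def)
qed

text \<open>Otherwise, removing the other cells, finitely many closed sets, from
  \<open>\<Omega>\<close> leaves a neighbourhood of \<open>p\<close> inside \<open>K\<close>,
  although edges contain no interior points of their cell.\<close>

lemma other_cell:
  assumes K: "K \<in> G" "e edge_of K" and p: "p \<in> e" "p \<in> \<Omega>"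
  shows "\<exists>K'\<in>G. K' \<noteq> K \<and> p \<in> K'"
proof (rule ccontr)
  assume no: "\<not> ?thesis"
  define U where "U = \<Omega> - \<Union>(G - {K})"
  have "closed (\<Union>(G - {K}))"
  proof (intro closed_Union ballI)
    fix T assume "T \<in> G - {K}"
    then have "T \<in> G" by simp
    show "closed T"
      by (subst cell_eq[OF \<open>T \<in> G\<close>]) (intro closed_Times closed_atLeastAtMost)
  qed (simp add: finite_grid)
  then have "open U"
    using open_domain by (auto simp: U_def)
  moreover have "U \<subseteq> K"
    using Union_grid closure_subset[of \<Omega>] by (auto simp: U_def)
  moreover have "p \<in> U"
    using no p by (auto simp: U_def)
  ultimately have "p \<in> interior K"
    by (auto intro: interiorI)
  then show False
    using edge_Int_interior[OF K] p by blast
qed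

text \<open>If the side were the right side of both cells, the cells would overlap, and its
  direction rules out the horizontal sides of \<open>K'\<close>. The three lemmas that follow treat
  the other sides in the same way.\<close>

lemma neighbour_x_hi:
  assumes "K \<in> G" "K' \<in> G" "K \<noteq> K'" "{x_hi K} \<times> {y_lo K..y_hi K} edge_of K'"
  shows "x_lo K' = x_hi K \<and> y_lo K' = y_lo K \<and> y_hi K' = y_hi K"
  using assms(4) cells_separated[OF assms(1-3)] cell_bounds(1,2)[OF assms(1)] cell_bounds(1,2)[OF assms(2)]
  unfolding edge_of_cell[OF assms(2)] by (auto simp: times_eq_iff Icc_eq_Icc singleton_iff)

lemma neighbour_x_lo:
  assumes "K \<in> G" "K' \<in> G" "K \<noteq> K'" "{x_lo K} \<times> {y_lo K..y_hi K} edge_of K'"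
  shows "x_hi K' = x_lo K \<and> y_lo K' = y_lo K \<and> y_hi K' = y_hi K"
  using assms(4) cells_separated[OF assms(1-3)] cell_bounds(1,2)[OF assms(1)] cell_bounds(1,2)[OF assms(2)]
  unfolding edge_of_cell[OF assms(2)] by (auto simp: times_eq_iff Icc_eq_Icc)

lemma neighbour_y_hi:
  assumes "K \<in> G" "K' \<in> G" "K \<noteq> K'" "{x_lo K..x_hi K} \<times> {y_hi K} edge_of K'"
  shows "y_lo K' = y_hi K \<and> x_lo K' = x_lo K \<and> x_hi K' = x_hi K"
  using assms(4) cells_separated[OF assms(1-3)] cell_bounds(1,2)[OF assms(1)] cell_bounds(1,2)[OF assms(2)]
  unfolding edge_of_cell[OF assms(2)] by (auto simp: times_eq_iff Icc_eq_Icc)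

lemma neighbour_y_lo:
  assumes "K \<in> G" "K' \<in> G" "K \<noteq> K'" "{x_lo K..x_hi K} \<times> {y_lo K} edge_of K'"
  shows "y_hi K' = y_lo K \<and> x_lo K' = x_lo K \<and> x_hi K' = x_hi K"
  using assms(4) cells_separated[OF assms(1-3)] cell_bounds(1,2)[OF assms(1)] cell_bounds(1,2)[OF assms(2)]
  unfolding edge_of_cell[OF assms(2)] by (auto simp: times_eq_iff Icc_eq_Icc)

text \<open>The two cells form a larger rectangle whose interior contains the open edge. That
  interior lies in \<open>interior (closure \<Omega>)\<close>, which is \<open>\<Omega>\<close>; so
  no slit runs along a common edge.\<close>

lemma edge_rel_interior_subset:
  assumes K: "K \<in> G" "K' \<in> G" "K \<noteq> K'" and e: "e edge_of K" "e edge_of K'"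
  shows "rel_interior e \<subseteq> \<Omega>"
proof -
  note b = cell_bounds(1,2)[OF K(1)] cell_bounds(1,2)[OF K(2)]
  have "interior (K \<union> K') \<subseteq> \<Omega>"
    using interior_mono[of "K \<union> K'" "closure \<Omega>"] Union_grid K interior_closure_domain by blast
  moreover have "{x_lo K<..<x_hi K'} \<times> {y_lo K<..<y_hi K} \<subseteq> interior (K \<union> K')"
    if "x_lo K' = x_hi K" "y_lo K' = y_lo K" "y_hi K' = y_hi K"
    by (rule interior_maximal)
      (use that in \<open>subst cell_eq[OF K(1)], subst cell_eq[OF K(2)], auto intro: open_Times\<close>)
  moreover have "{x_lo K'<..<x_hi K} \<times> {y_lo K<..<y_hi K} \<subseteq> interior (K \<union> K')"
    if "x_hi K' = x_lo K" "y_lo K' = y_lo K" "y_hi K' = y_hi K"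
    by (rule interior_maximal)
      (use that in \<open>subst cell_eq[OF K(1)], subst cell_eq[OF K(2)], auto intro: open_Times\<close>)
  moreover have "{x_lo K<..<x_hi K} \<times> {y_lo K<..<y_hi K'} \<subseteq> interior (K \<union> K')"
    if "y_lo K' = y_hi K" "x_lo K' = x_lo K" "x_hi K' = x_hi K"
    by (rule interior_maximal)
      (use that in \<open>subst cell_eq[OF K(1)], subst cell_eq[OF K(2)], auto intro: open_Times\<close>)
  moreover have "{x_lo K<..<x_hi K} \<times> {y_lo K'<..<y_hi K} \<subseteq> interior (K \<union> K')"
    if "y_hi K' = y_lo K" "x_lo K' = x_lo K" "x_hi K' = x_hi K"
    by (rule interior_maximal)
      (use that in \<open>subst cell_eq[OF K(1)], subst cell_eq[OF K(2)], auto intro: open_Times\<close>)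
  ultimately have sub: "x_lo K' = x_hi K \<and> y_lo K' = y_lo K \<and> y_hi K' = y_hi K \<Longrightarrow> {x_hi K} \<times> {y_lo K<..<y_hi K} \<subseteq> \<Omega>"
    "x_hi K' = x_lo K \<and> y_lo K' = y_lo K \<and> y_hi K' = y_hi K \<Longrightarrow> {x_lo K} \<times> {y_lo K<..<y_hi K} \<subseteq> \<Omega>"
    "y_lo K' = y_hi K \<and> x_lo K' = x_lo K \<and> x_hi K' = x_hi K \<Longrightarrow> {x_lo K<..<x_hi K} \<times> {y_hi K} \<subseteq> \<Omega>"
    "y_hi K' = y_lo K \<and> x_lo K' = x_lo K \<and> x_hi K' = x_hi K \<Longrightarrow> {x_lo K<..<x_hi K} \<times> {y_lo K} \<subseteq> \<Omega>"
    using b by (auto simp: subset_iff)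
  show ?thesis
    using e(1) sub neighbour_x_hi[OF K] neighbour_x_lo[OF K] neighbour_y_hi[OF K] neighbour_y_lo[OF K] e(2)
    unfolding edge_of_cell[OF K(1)] by (elim disjE) (simp_all add: rel_interior_rectangle b)
qed

text \<open>An edge not contained in the frontier meets the open set \<open>\<Omega>\<close>, and
  then does so in its relative interior. A second cell through such a point shares the whole
  edge.\<close>

lemma edge_cases:
  assumes K: "K \<in> G" "e edge_of K"
  shows "e \<in> boundary_edges \<Omega> G \<or>
    (e \<in> interior_edges \<Omega> G \<and> (\<exists>K'\<in>G. K' \<noteq> K \<and> e edge_of K'))"
proof (cases "e \<subseteq> frontier \<Omega>")
  case True
  then show ?thesis
    using K by (auto simp: boundary_edges_def edges_def)
next
  case False
  have eK: "e \<subseteq> K" "convex e"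
    using K edge_of_imp_subset face_of_imp_convex cell_eq[OF K(1)]
    by (auto simp: edge_of_def)
  have "e \<subseteq> closure \<Omega>"
    using eK K Union_grid by blast
  then have "e \<inter> \<Omega> \<noteq> {}"
    using False open_domain by (auto simp: frontier_def interior_open)
  moreover have "e \<subseteq> closure (rel_interior e)"
    using convex_closure_rel_interior[OF eK(2)] closure_subset by blast
  ultimately obtain p where p: "p \<in> rel_interior e" "p \<in> \<Omega>"
    using open_Int_closure_eq_empty[OF open_domain, of "rel_interior e"] by blast
  then obtain K' where K': "K' \<in> G" "K' \<noteq> K" "p \<in> K'"
    using other_cell[OF K, of p] rel_interior_subset by blast
  then have "e edge_of K'"
    using shared_edge[of K K' e p] K p by blast
  moreover have "rel_interior e \<subseteq> \<Omega>"
    using edge_rel_interior_subset[of K K' e] K K' \<open>e edge_of K'\<close> by blast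
  ultimately show ?thesis
    using K K' by (auto simp: interior_edges_def edges_def)
qed

section \<open>Vertices and the frontier\<close>

lemma vertex_corner:
  assumes "p \<in> vertices G" "K \<in> G" "p \<in> K"
  shows "p \<in> {x_lo K, x_hi K} \<times> {y_lo K, y_hi K}"
proof -
  obtain K' where K': "K' \<in> G" "p extreme_point_of K'"
    using assms by (auto simp: vertices_def)
  then have "p extreme_point_of (K' \<inter> K)"
    using assms by (auto simp: extreme_point_of_def)
  \<comment> \<open>As no node hangs, the intersection is a face of \<open>K\<close>, and extreme
    points of a face are extreme points of the cell.\<close>
  then have "p extreme_point_of K"
    using extreme_point_of_face[OF face_Int[OF assms(2) K'(1)]] by (simp add: Int_commute)
  then show ?thesis
    using extreme_point_of_rectangle[OF cell_bounds(1,2)[OF assms(2)]] cell_eq[OF assms(2)] by simp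
qed

lemma corner_vertex:
  assumes "K \<in> G" "p \<in> {x_lo K, x_hi K} \<times> {y_lo K, y_hi K}"
  shows "p \<in> vertices G"
  using extreme_point_of_rectangle[OF cell_bounds(1,2)[OF assms(1)], of p] cell_eq[OF assms(1)] assms
  by (auto simp: vertices_def)

lemma vertex_cases:
  assumes "p \<in> vertices G"
  shows "p \<in> interior_vertices \<Omega> G \<or> p \<in> boundary_vertices \<Omega> G"
proof -
  have "p \<in> closure \<Omega>"
    using assms Union_grid by (auto simp: vertices_def extreme_point_of_def)
  then show ?thesis
    using assms open_domain by (auto simp: interior_vertices_def boundary_vertices_def frontier_def interior_open)
qed

lemma finite_vertices: "finite (vertices G)"
proof (rule finite_subset)
  show "vertices G \<subseteq> (\<Union>K\<in>G. {x_lo K, x_hi K} \<times> {y_lo K, y_hi K})"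
    using vertex_corner by (auto simp: vertices_def extreme_point_of_def) blast
qed (simp add: finite_grid)

lemma finite_edges: "finite (edges G)"
proof (rule finite_subset)
  show "edges G \<subseteq> (\<Union>K\<in>G. {{x_lo K} \<times> {y_lo K..y_hi K}, {x_hi K} \<times> {y_lo K..y_hi K},
      {x_lo K..x_hi K} \<times> {y_lo K}, {x_lo K..x_hi K} \<times> {y_hi K}})"
    by (auto simp: edges_def edge_of_cell)
qed (simp add: finite_grid)

text \<open>A frontier point is not in \<open>\<Omega>\<close>, hence in no open cell. If it is no
  corner either, it lies in the relative interior of an edge, which then cannot be an interior
  edge.\<close>

lemma nonvertex_in_boundary_edge:
  assumes q: "q \<in> frontier \<Omega>" "q \<notin> vertices G"
  shows "\<exists>e\<in>boundary_edges \<Omega> G. q \<in> e"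
proof -
  obtain K where K: "K \<in> G" "q \<in> K"
    using q Union_grid by (auto simp: frontier_def)
  obtain x y where xy: "q = (x, y)" by fastforce
  note b = cell_bounds(1,2)[OF K(1)]
  have q_out: "q \<notin> \<Omega>"
    using q open_domain by (auto simp: frontier_def interior_open)
  have "interior K \<subseteq> \<Omega>"
    using interior_mono[of K "closure \<Omega>"] Union_grid K interior_closure_domain by blast
  then have "q \<notin> interior K" 
    using q_out by blast
  moreover have "q \<notin> {x_lo K, x_hi K} \<times> {y_lo K, y_hi K}"
    using corner_vertex[OF K(1)] q by blast
  moreover have "x_lo K \<le> x \<and> x \<le> x_hi K \<and> y_lo K \<le> y \<and> y \<le> y_hi K"
    using K(2) cell_eq[OF K(1)] unfolding xy by (metis mem_Times_iff atLeastAtMost_iff fst_conv snd_conv)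
  then have "x = x_lo K \<or> x = x_hi K \<or> x_lo K < x \<and> x < x_hi K"
    "y = y_lo K \<or> y = y_hi K \<or> y_lo K < y \<and> y < y_hi K"
    by linarith+
  ultimately have "q \<in> {x_lo K} \<times> {y_lo K<..<y_hi K} \<or> q \<in> {x_hi K} \<times> {y_lo K<..<y_hi K} \<or>
      q \<in> {x_lo K<..<x_hi K} \<times> {y_lo K} \<or> q \<in> {x_lo K<..<x_hi K} \<times> {y_hi K}"
    unfolding interior_cell[OF K(1)] xy mem_Times_iff fst_conv snd_conv insert_iff empty_iff greaterThanLessThan_iff
    by blast
  then have "\<exists>e. e edge_of K \<and> q \<in> rel_interior e"
    unfolding edge_of_cell[OF K(1)] by (metis rel_interior_rectangle b)
  then obtain e where e: "e edge_of K" "q \<in> rel_interior e" by blast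
  then have "e \<in> boundary_edges \<Omega> G"
    using edge_cases[OF K(1) e(1)] q_out by (auto simp: interior_edges_def)
  then show ?thesis
    using e rel_interior_subset by blast
qed

text \<open>
  Near a point of the frontier, a punctured disc is connected and free of vertices, and it meets
  \<open>closure \<Omega>\<close> and its complement, hence contains a non-vertex of the frontier.
\<close>

lemma frontier_subset_boundary_edges: "frontier \<Omega> \<subseteq> \<Union>(boundary_edges \<Omega> G)"
proof
  fix p assume p: "p \<in> frontier \<Omega>"
  let ?B = "\<Union>(boundary_edges \<Omega> G)"
  show "p \<in> ?B"
  proof (rule ccontr)
    assume "p \<notin> ?B"
    \<comment> \<open>The point \<open>p\<close> may itself be a vertex, so only the other vertices
      are removed.\<close>
    define U where "U = - ?B - (vertices G - {p})"
    have "closed ?B"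
    proof (intro closed_Union ballI)
      show "finite (boundary_edges \<Omega> G)"
        using finite_edges by (auto simp: boundary_edges_def)
      fix e assume "e \<in> boundary_edges \<Omega> G"
      then obtain K where "K \<in> G" "e edge_of K"
        by (auto simp: boundary_edges_def edges_def)
      then show "closed e"
        by (auto simp: edge_of_cell intro!: closed_Times)
    qed
    then have "open U"
      using finite_vertices by (auto simp: U_def intro!: open_Diff finite_imp_closed)
    moreover have "p \<in> U"
      using \<open>p \<notin> ?B\<close> by (auto simp: U_def)
    ultimately obtain r where r: "r > 0" "ball p r \<subseteq> U"
      using open_contains_ball by blast
    \<comment> \<open>Because \<open>interior (closure \<Omega>) = \<Omega>\<close>, every ball
      about a frontier point contains points outside \<open>closure \<Omega>\<close>.\<close>
    have p_bd: "p \<in> frontier (closure \<Omega>)"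
      using p open_domain by (auto simp: frontier_def interior_closure_domain interior_open)
    have "\<not> ball p r \<subseteq> closure \<Omega>"
      using p_bd r interior_maximal[of "ball p r" "closure \<Omega>"] centre_in_ball[of p r]
      unfolding frontier_def by (metis DiffD2 open_ball subsetD)
    moreover have "p \<in> closure \<Omega>" using p by (auto simp: frontier_def)
    ultimately have diff: "(ball p r - {p}) - closure \<Omega> \<noteq> {}"
      by blast
    have "\<Omega> \<inter> ball p r \<noteq> {}"
      using \<open>p \<in> closure \<Omega>\<close> r(1) by (metis IntI closure_approachable dist_commute empty_iff mem_ball)
    moreover have "p \<notin> \<Omega>"
      using p open_domain by (auto simp: frontier_def interior_open)
    ultimately have meet: "(ball p r - {p}) \<inter> closure \<Omega> \<noteq> {}"
      using closure_subset[of \<Omega>] by blast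
    have "connected (ball p r - {p})"
      using r aff_dim_nonempty_interior[of "ball p r"]
      by (intro connected_punctured_convex) (auto simp: interior_open)
    then obtain q where q: "q \<in> ball p r" "q \<noteq> p" "q \<in> frontier (closure \<Omega>)"
      using connected_Int_frontier[OF _ meet diff] by blast
    then have "q \<in> frontier \<Omega>"
      by (simp add: frontier_def interior_closure_domain interior_open[OF open_domain])
    moreover have "q \<in> U" using q r by blast
    ultimately show False
      using nonvertex_in_boundary_edge[of q] q(2) by (auto simp: U_def)
  qed
qed

end

section \<open>Piecewise polynomials and edge means\<close>

lemma poly_space_continuous:
  assumes "p \<in> poly_space k"
  shows "continuous_on UNIV p"
proof -
  obtain c where "\<And>x y. p (x, y) = (\<Sum>i\<le>k. \<Sum>j\<le>k - i. c i j * x ^ i * y ^ j)"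
    using assms by (auto simp: poly_space_def)
  then have "p = (\<lambda>q. \<Sum>i\<le>k. \<Sum>j\<le>k - i. c i j * fst q ^ i * snd q ^ j)"
    by (metis prod.collapse)
  then show ?thesis
    by (simp add: continuous_intros)
qed

lemma poly_space_1_iff:
  "p \<in> poly_space 1 \<longleftrightarrow> (\<exists>\<alpha> \<beta> \<gamma>. \<forall>x y. p (x, y) = \<alpha> + \<beta> * x + \<gamma> * y)"
proof
  assume "p \<in> poly_space 1"
  then obtain c where c: "\<And>x y. p (x, y) = (\<Sum>i\<le>1. \<Sum>j\<le>1 - i. c i j * x ^ i * y ^ j)"
    unfolding poly_space_def by blast
  have "p (x, y) = c 0 0 + c 1 0 * x + c 0 1 * y" for x y
    unfolding c by (simp add: atMost_Suc)
  then show "\<exists>\<alpha> \<beta> \<gamma>. \<forall>x y. p (x, y) = \<alpha> + \<beta> * x + \<gamma> * y"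
    by blast
next
  assume "\<exists>\<alpha> \<beta> \<gamma>. \<forall>x y. p (x, y) = \<alpha> + \<beta> * x + \<gamma> * y"
  then obtain \<alpha> \<beta> \<gamma> where p: "\<And>x y. p (x, y) = \<alpha> + \<beta> * x + \<gamma> * y"
    by blast
  define c :: "nat \<Rightarrow> nat \<Rightarrow> real" where "c i j = (if i = 1 then \<beta> else if j = 1 then \<gamma> else \<alpha>)" for i j
  have "p (x, y) = (\<Sum>i\<le>1. \<Sum>j\<le>1 - i. c i j * x ^ i * y ^ j)" for x y
    unfolding p by (simp add: atMost_Suc c_def)
  then show "p \<in> poly_space 1"
    unfolding poly_space_def by blast
qed

definition quadratic :: "real \<Rightarrow> real \<Rightarrow> real \<Rightarrow> real \<Rightarrow> real \<Rightarrow> real \<Rightarrow> point \<Rightarrow> real" where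
  "quadratic c0 c1 c2 c3 c4 c5 p =
    c0 + c1 * fst p + c2 * snd p + c3 * (fst p)\<^sup>2 + c4 * fst p * snd p + c5 * (snd p)\<^sup>2"

lemma poly_space_2_iff: "p \<in> poly_space 2 \<longleftrightarrow> (\<exists>c0 c1 c2 c3 c4 c5. p = quadratic c0 c1 c2 c3 c4 c5)"
proof
  assume "p \<in> poly_space 2"
  then obtain c where c: "\<And>x y. p (x, y) = (\<Sum>i\<le>2. \<Sum>j\<le>2 - i. c i j * x ^ i * y ^ j)"
    unfolding poly_space_def by blast
  have "p q = quadratic (c 0 0) (c 1 0) (c 0 1) (c 2 0) (c 1 1) (c 0 2) q" for q
    unfolding quadratic_def by (cases q) (simp add: c atMost_Suc numeral_2_eq_2)
  then show "\<exists>c0 c1 c2 c3 c4 c5. p = quadratic c0 c1 c2 c3 c4 c5"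
    by blast
next
  assume "\<exists>c0 c1 c2 c3 c4 c5. p = quadratic c0 c1 c2 c3 c4 c5"
  then obtain c0 c1 c2 c3 c4 c5 where p: "p = quadratic c0 c1 c2 c3 c4 c5"
    by blast
  define c :: "nat \<Rightarrow> nat \<Rightarrow> real" where
    "c i j = (if i = 2 then c3 else if j = 2 then c5 else if i = 1 then (if j = 1 then c4 else c1) else if j = 1 then c2 else c0)" for i j
  have "p (x, y) = (\<Sum>i\<le>2. \<Sum>j\<le>2 - i. c i j * x ^ i * y ^ j)" for x y
    unfolding p quadratic_def by (simp add: atMost_Suc numeral_2_eq_2 c_def)
  then show "p \<in> poly_space 2"
    unfolding poly_space_def by blast
qed

text \<open>The gradient is affine along the segment, and the midpoint rule is exact for affine
  functions. The two factors are the partial derivatives at the midpoint.\<close>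

lemma quadratic_midpoint_rule:
  "quadratic c0 c1 c2 c3 c4 c5 b - quadratic c0 c1 c2 c3 c4 c5 a =
    (c1 + 2 * c3 * ((fst a + fst b) / 2) + c4 * ((snd a + snd b) / 2)) * fst (b - a) +
    (c2 + c4 * ((fst a + fst b) / 2) + 2 * c5 * ((snd a + snd b) / 2)) * snd (b - a)"
  by (simp add: quadratic_def field_simps power2_eq_square)

lemma isCont_quadratic: "isCont (quadratic c0 c1 c2 c3 c4 c5) p"
  unfolding quadratic_def by (intro continuous_intros)

text \<open>Pulled back to \<open>{0..1}\<close> the function is \<open>u + v * t\<close>, with mean
  \<open>u + v / 2\<close>, which is the value at the midpoint.\<close>

lemma edge_mean_affine:
  assumes "\<And>p. p \<in> closed_segment a b \<Longrightarrow> f p = \<alpha> + \<beta> * fst p + \<gamma> * snd p"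
  shows "edge_mean a b f = \<alpha> + \<beta> * ((fst a + fst b) / 2) + \<gamma> * ((snd a + snd b) / 2)"
proof -
  define u where "u = \<alpha> + \<beta> * fst a + \<gamma> * snd a"
  define v where "v = \<beta> * fst (b - a) + \<gamma> * snd (b - a)"
  have "edge_mean a b f = integral {0..1} (\<lambda>t. u + v * t)"
    unfolding edge_mean_def
  proof (rule integral_cong)
    fix t :: real assume "t \<in> {0..1}"
    then have "linepath a b t \<in> closed_segment a b"
      by (simp add: linepath_in_path)
    then show "f (linepath a b t) = u + v * t"
      by (simp add: assms) (simp add: linepath_def u_def v_def algebra_simps)
  qed
  also have "((\<lambda>t. u + v * t) has_integral (u * 1 + v * (1\<^sup>2 / 2)) - (u * 0 + v * (0\<^sup>2 / 2))) {0..1}"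
    by (rule fundamental_theorem_of_calculus)
      (auto intro!: derivative_eq_intros simp flip: has_real_derivative_iff_has_vector_derivative)
  then have "integral {0..1} (\<lambda>t. u + v * t) = u + v / 2"
    by (simp add: integral_unique)
  finally show ?thesis
    by (simp add: u_def v_def field_simps)
qed

text \<open>The horizontal line through \<open>p\<close> meets \<open>U\<close> in an open set of
  parameters, so agreement on \<open>U\<close> suffices. In this way functions given cell by cell
  are differentiated.\<close>

lemma partial_x_eq:
  assumes "open U" "p \<in> U" "\<And>q. q \<in> U \<Longrightarrow> w q = g q"
    and "((\<lambda>s. g (s, snd p)) has_real_derivative D) (at (fst p))"
  shows "partial_x w p = D"
  unfolding partial_x_def
proof (rule DERIV_imp_deriv)
  have "open ((\<lambda>s. (s, snd p)) -` U)"
    by (rule open_vimage[OF assms(1)]) (intro continuous_intros)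
  then show "((\<lambda>s. w (s, snd p)) has_real_derivative D) (at (fst p))"
    using assms(2,3) by (intro has_field_derivative_transform_within_open[OF assms(4)]) auto
qed

lemma partial_y_eq:
  assumes "open U" "p \<in> U" "\<And>q. q \<in> U \<Longrightarrow> w q = g q"
    and "((\<lambda>s. g (fst p, s)) has_real_derivative D) (at (snd p))"
  shows "partial_y w p = D"
  unfolding partial_y_def
proof (rule DERIV_imp_deriv)
  have "open ((\<lambda>s. (fst p, s)) -` U)"
    by (rule open_vimage[OF assms(1)]) (intro continuous_intros)
  then show "((\<lambda>s. w (fst p, s)) has_real_derivative D) (at (snd p))"
    using assms(2,3) by (intro has_field_derivative_transform_within_open[OF assms(4)]) auto
qed

lemma partial_quadratic:
  assumes "open U" "p \<in> U" "\<And>q. q \<in> U \<Longrightarrow> w q = quadratic c0 c1 c2 c3 c4 c5 q"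
  shows "partial_x w p = c1 + 2 * c3 * fst p + c4 * snd p"
    and "partial_y w p = c2 + c4 * fst p + 2 * c5 * snd p"
  by (rule partial_x_eq[OF assms] partial_y_eq[OF assms];
      auto simp: quadratic_def intro!: derivative_eq_intros)+

section \<open>Traces and edge means on the grid\<close>

context domain_grid
begin

lemma cellwise_interior: "K \<in> G \<Longrightarrow> p \<in> interior K \<Longrightarrow> cellwise G f p = f p"
  by (auto simp: cellwise_def)

text \<open>Every point of a cell is a limit point of its interior, so \<open>Lim\<close> denotes a
  genuine limit, and it sees \<open>f\<close> only in the interior.\<close>

lemma cell_trace_eq:
  assumes K: "K \<in> G" "p \<in> K" and f: "\<And>q. q \<in> interior K \<Longrightarrow> f q = g q" and g: "isCont g p"
  shows "cell_trace K f p = g p"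
  unfolding cell_trace_def
proof (rule tendsto_Lim)
  have "p \<in> closure (interior K)"
    using K(2) cell_eq[OF K(1)] cell_bounds(1,2)[OF K(1)]
    by (simp add: interior_cell[OF K(1)] closure_Times)
  then have "p islimpt interior K"
    using interior_limit_point[of p "interior K"] by (auto simp: closure_def)
  then show "\<not> trivial_limit (at p within interior K)"
    by (simp add: trivial_limit_within)
  have "(g \<longlongrightarrow> g p) (at p within interior K)"
    using g by (simp add: isCont_def tendsto_within_subset[of _ _ _ UNIV])
  then show "(f \<longlongrightarrow> g p) (at p within interior K)"
    by (rule Lim_transform_eventually) (auto simp: eventually_at_filter f)
qed

lemma edge_mean_trace:
  assumes "K \<in> G" "closed_segment a b \<subseteq> K"
    and f: "\<And>p. p \<in> interior K \<Longrightarrow> f p = \<alpha> + \<beta> * fst p + \<gamma> * snd p"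
  shows "edge_mean a b (cell_trace K f) = \<alpha> + \<beta> * ((fst a + fst b) / 2) + \<gamma> * ((snd a + snd b) / 2)"
proof (rule edge_mean_affine)
  fix p assume "p \<in> closed_segment a b"
  then show "cell_trace K f p = \<alpha> + \<beta> * fst p + \<gamma> * snd p"
    using assms by (intro cell_trace_eq[where g = "\<lambda>p. \<alpha> + \<beta> * fst p + \<gamma> * snd p"] continuous_intros) auto
qed

lemma edge_mean_jump:
  assumes "K \<in> G" "closed_segment a b \<subseteq> K" "K' \<in> G" "closed_segment a b \<subseteq> K'"
    and f: "\<And>p. p \<in> interior K \<Longrightarrow> f p = \<alpha> + \<beta> * fst p + \<gamma> * snd p"
    and f': "\<And>p. p \<in> interior K' \<Longrightarrow> f p = \<alpha>' + \<beta>' * fst p + \<gamma>' * snd p"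
  shows "edge_mean a b (jump K K' f) =
    \<alpha> + \<beta> * ((fst a + fst b) / 2) + \<gamma> * ((snd a + snd b) / 2) -
    (\<alpha>' + \<beta>' * ((fst a + fst b) / 2) + \<gamma>' * ((snd a + snd b) / 2))"
proof -
  have "edge_mean a b (jump K K' f) = (\<alpha> - \<alpha>') + (\<beta> - \<beta>') * ((fst a + fst b) / 2) + (\<gamma> - \<gamma>') * ((snd a + snd b) / 2)"
  proof (rule edge_mean_affine)
    fix p assume "p \<in> closed_segment a b"
    then have "cell_trace K f p = \<alpha> + \<beta> * fst p + \<gamma> * snd p" "cell_trace K' f p = \<alpha>' + \<beta>' * fst p + \<gamma>' * snd p"
      using assms by (auto intro!: cell_trace_eq[where g = "\<lambda>p. \<alpha> + \<beta> * fst p + \<gamma> * snd p"]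
          cell_trace_eq[where g = "\<lambda>p. \<alpha>' + \<beta>' * fst p + \<gamma>' * snd p"] continuous_intros)
    then show "jump K K' f p = (\<alpha> - \<alpha>') + (\<beta> - \<beta>') * fst p + (\<gamma> - \<gamma>') * snd p"
      by (simp add: jump_def algebra_simps)
  qed
  then show ?thesis by (simp add: left_diff_distrib diff_divide_distrib)
qed

lemma edge_endpoints:
  assumes "K \<in> G" "closed_segment a b edge_of K"
  shows "a \<in> vertices G" "b \<in> vertices G" "a \<in> K" "b \<in> K" "a \<noteq> b" "closed_segment a b \<subseteq> K"
proof -
  have face: "closed_segment a b face_of K" and dim: "aff_dim (closed_segment a b) = 1"
    using assms by (auto simp: edge_of_def)
  show sub: "closed_segment a b \<subseteq> K"
    by (rule face_of_imp_subset[OF face])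
  then show "a \<in> K" "b \<in> K" by auto
  show "a \<noteq> b" using dim by auto
  have "a extreme_point_of K" "b extreme_point_of K"
    using extreme_point_of_face[OF face] extreme_point_of_segment by blast+
  then show "a \<in> vertices G" "b \<in> vertices G"
    using assms by (auto simp: vertices_def)
qed

text \<open>Square integrability is automatic: a finite sum of continuous functions cut off to open
  cells is measurable, it is bounded since cells are compact, and a bounded open set has finite
  measure.\<close>

lemma piecewise_P_I:
  assumes w: "\<And>K. K \<in> G \<Longrightarrow> \<exists>p\<in>poly_space k. \<forall>x\<in>interior K. w x = p x"
    and off: "\<And>x. x \<notin> (\<Union>K\<in>G. interior K) \<Longrightarrow> w x = 0"
  shows "w \<in> piecewise_P k \<Omega> G"
proof -
  obtain f where f: "\<And>K. K \<in> G \<Longrightarrow> f K \<in> poly_space k" "\<And>K x. K \<in> G \<Longrightarrow> x \<in> interior K \<Longrightarrow> w x = f K x"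
    using w by metis
  have cont: "continuous_on A (f K)" if "K \<in> G" for A K
    using poly_space_continuous[OF f(1)[OF that]] continuous_on_subset by blast
  have w_eq: "w x = (\<Sum>K\<in>G. indicator (interior K) x * f K x)" for x
  proof (cases "x \<in> (\<Union>K\<in>G. interior K)")
    case True
    then obtain K where K: "K \<in> G" "x \<in> interior K" by blast
    have "(\<Sum>K\<in>G. indicator (interior K) x * f K x) = (\<Sum>K\<in>{K}. indicator (interior K) x * f K x)"
      using finite_grid interiors_disjoint K by (intro sum.mono_neutral_right) (auto simp: indicator_def)
    then show ?thesis
      using K f(2) by simp
  next
    case False
    then show ?thesis
      by (simp add: off indicator_def)
  qed
  have "(\<lambda>x. \<Sum>K\<in>G. indicator (interior K) x * f K x) \<in> borel_measurable borel"
    using cont by (intro borel_measurable_sum borel_measurable_times borel_measurable_indicator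
        borel_measurable_continuous_onI) auto
  then have "w \<in> borel_measurable borel"
    by (simp add: w_eq[abs_def])
  then have meas: "w \<in> borel_measurable (lebesgue_on \<Omega>)"
    by (intro measurable_restrict_space1 measurable_completion) simp
  have "\<exists>B. \<forall>x\<in>interior K. \<bar>f K x\<bar> \<le> B" if "K \<in> G" for K
  proof -
    have "compact K"
      by (subst cell_eq[OF that]) (intro compact_Times compact_Icc)
    then have "bounded (f K ` K)"
      using cont[OF that] by (intro compact_imp_bounded compact_continuous_image)
    then show ?thesis
      unfolding bounded_iff using interior_subset by fastforce
  qed
  then obtain B where B: "\<And>K x. K \<in> G \<Longrightarrow> x \<in> interior K \<Longrightarrow> \<bar>f K x\<bar> \<le> B K"
    by metis
  define M where "M = (\<Sum>K\<in>G. \<bar>B K\<bar>)"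
  have "\<bar>w x\<bar> \<le> M" for x
  proof -
    have "\<bar>w x\<bar> \<le> (\<Sum>K\<in>G. \<bar>indicator (interior K) x * f K x\<bar>)"
      unfolding w_eq by (rule sum_abs)
    also have "\<dots> \<le> M"
      unfolding M_def
    proof (rule sum_mono)
      fix K assume "K \<in> G"
      then show "\<bar>indicator (interior K) x * f K x\<bar> \<le> \<bar>B K\<bar>"
        using B[of K x] by (auto simp: indicator_def)
    qed
    finally show ?thesis .
  qed
  then have "(w x)\<^sup>2 \<le> M\<^sup>2" for x
    by (metis abs_ge_zero power2_abs power_mono)
  moreover have "finite_measure (lebesgue_on \<Omega>)"
    by (intro finite_measure_lebesgue_on lmeasurable_open bounded_domain open_domain)
  ultimately have "integrable (lebesgue_on \<Omega>) (\<lambda>x. (w x)\<^sup>2)"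
    using meas by (intro finite_measure.integrable_const_bound[where B = "M\<^sup>2"]) auto
  then show ?thesis
    using meas w off unfolding piecewise_P_def square_integrable_on_def by blast
qed

section \<open>Curls of Morley functions\<close>

text \<open>At an interior vertex this is continuity; at a boundary vertex both traces vanish. The
  uniform statement serves interior edges with endpoints on the boundary.\<close>

lemma vertex_trace_eq:
  assumes "w \<in> V_hs_R \<Omega> G" "K \<in> G" "K' \<in> G" "p \<in> vertices G" "p \<in> K" "p \<in> K'"
  shows "cell_trace K w p = cell_trace K' w p"
  using vertex_cases[OF assms(4)]
proof
  assume "p \<in> interior_vertices \<Omega> G"
  then show ?thesis
    using assms unfolding V_hs_R_def by blast
next
  assume "p \<in> boundary_vertices \<Omega> G"
  then have "cell_trace K w p = 0" "cell_trace K' w p = 0"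
    using assms unfolding V_hs_R_def by blast+
  then show ?thesis by simp
qed

text \<open>The normal component of the curl on an edge is the tangential derivative of
  \<open>w\<close>, so its flux is a difference of vertex values, which vanishes on the boundary. In
  the divergence the mixed derivatives cancel.\<close>

lemma curl_h_in_V_PS_hn:
  assumes w: "w \<in> V_hs_R \<Omega> G"
  shows "curl_h G w \<in> V_PS_hn \<Omega> G" and "div_h G (curl_h G w) x = 0"
proof -
  \<comment> \<open>Membership in \<open>G\<close> stands inside the existential, so that choice
    yields coefficient functions defined for all \<open>K\<close>.\<close>
  have "\<exists>c0 c1 c2 c3 c4 c5. K \<in> G \<longrightarrow> (\<forall>p\<in>interior K. w p = quadratic c0 c1 c2 c3 c4 c5 p)" for K
  proof (cases "K \<in> G")
    case True
    have "\<forall>K\<in>G. \<exists>p\<in>poly_space 2. \<forall>x\<in>interior K. w x = p x"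
      using w by (simp add: V_hs_R_def piecewise_P_def)
    then obtain p where "p \<in> poly_space 2" and p: "\<forall>x\<in>interior K. w x = p x"
      using True by blast
    then obtain c0 c1 c2 c3 c4 c5 where "p = quadratic c0 c1 c2 c3 c4 c5"
      unfolding poly_space_2_iff by (elim exE)
    then have "K \<in> G \<longrightarrow> (\<forall>x\<in>interior K. w x = quadratic c0 c1 c2 c3 c4 c5 x)"
      using p by simp
    then show ?thesis
      by (intro exI)
  qed simp
  then have "\<forall>K. \<exists>c0 c1 c2 c3 c4 c5. K \<in> G \<longrightarrow> (\<forall>p\<in>interior K. w p = quadratic c0 c1 c2 c3 c4 c5 p)"
    by blast
  then obtain c0 c1 c2 c3 c4 c5 where
    "\<forall>K. K \<in> G \<longrightarrow> (\<forall>p\<in>interior K. w p = quadratic (c0 K) (c1 K) (c2 K) (c3 K) (c4 K) (c5 K) p)"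
    unfolding choice_iff by (elim exE)
  then have w_eq: "w p = quadratic (c0 K) (c1 K) (c2 K) (c3 K) (c4 K) (c5 K) p" if "K \<in> G" "p \<in> interior K" for K p
    using that by blast
  define q where "q K = quadratic (c0 K) (c1 K) (c2 K) (c3 K) (c4 K) (c5 K)" for K
  define gx where "gx K p = c1 K + 2 * c3 K * fst p + c4 K * snd p" for K p
  define gy where "gy K p = c2 K + c4 K * fst p + 2 * c5 K * snd p" for K and p :: point
  have partial: "partial_x w p = gx K p" "partial_y w p = gy K p" if "K \<in> G" "p \<in> interior K" for K p
    unfolding gx_def gy_def using that by (auto intro!: partial_quadratic[OF open_interior _ w_eq])
  have curl: "curl_h G w p = (gy K p, - gx K p)" and grad: "grad_h G w p = (gx K p, gy K p)"
    if "K \<in> G" "p \<in> interior K" for K p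
    using that by (auto simp: curl_h_def grad_h_def cellwise_interior partial)
  have off: "curl_h G w p = 0" if "p \<notin> (\<Union>K\<in>G. interior K)" for p
    using that by (simp add: curl_h_def cellwise_def)
  have trace: "cell_trace K w p = q K p" if "K \<in> G" "p \<in> K" for K p
    unfolding q_def using that by (intro cell_trace_eq w_eq isCont_quadratic)
  define m where "m a b = ((fst a + fst b) / 2, (snd a + snd b) / 2)" for a b :: point
  have midpoint_rule: "q K b - q K a = gx K (m a b) * fst (b - a) + gy K (m a b) * snd (b - a)" for K a b
    unfolding q_def quadratic_midpoint_rule gx_def gy_def m_def by simp
  have mean_normal: "edge_mean a b (cell_trace K (\<lambda>x. grad_h G w x \<bullet> unit_normal a b)) =
      (gx K (m a b) * snd (b - a) - gy K (m a b) * fst (b - a)) / norm (b - a)"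
    if "K \<in> G" "closed_segment a b \<subseteq> K" for K a b
  proof -
    let ?n = "unit_normal a b"
    have "edge_mean a b (cell_trace K (\<lambda>x. grad_h G w x \<bullet> ?n)) =
      (c1 K * fst ?n + c2 K * snd ?n) + (2 * c3 K * fst ?n + c4 K * snd ?n) * ((fst a + fst b) / 2) +
      (c4 K * fst ?n + 2 * c5 K * snd ?n) * ((snd a + snd b) / 2)"
      using that by (intro edge_mean_trace) (simp_all add: grad[OF that(1)] gx_def gy_def inner_prod_def algebra_simps)
    also have "\<dots> = gx K (m a b) * fst ?n + gy K (m a b) * snd ?n"
      by (simp add: gx_def gy_def m_def algebra_simps)
    also have "\<dots> = (gx K (m a b) * snd (b - a) - gy K (m a b) * fst (b - a)) / norm (b - a)"
      by (simp add: unit_normal_def diff_divide_distrib right_diff_distrib)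
    finally show ?thesis .
  qed
  have mean_curl: "edge_mean a b (cell_trace K (\<lambda>x. curl_h G w x \<bullet> unit_normal a b)) = (q K b - q K a) / norm (b - a)"
    if "K \<in> G" "closed_segment a b \<subseteq> K" for K a b
  proof -
    let ?n = "unit_normal a b"
    have "edge_mean a b (cell_trace K (\<lambda>x. curl_h G w x \<bullet> ?n)) =
      (c2 K * fst ?n - c1 K * snd ?n) + (c4 K * fst ?n - 2 * c3 K * snd ?n) * ((fst a + fst b) / 2) +
      (2 * c5 K * fst ?n - c4 K * snd ?n) * ((snd a + snd b) / 2)"
      using that by (intro edge_mean_trace) (simp_all add: curl[OF that(1)] gx_def gy_def inner_prod_def algebra_simps)
    also have "\<dots> = gy K (m a b) * fst ?n - gx K (m a b) * snd ?n"
      by (simp add: gx_def gy_def m_def algebra_simps)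
    also have "\<dots> = (q K b - q K a) / norm (b - a)"
      by (simp add: unit_normal_def midpoint_rule add_divide_distrib diff_divide_distrib right_diff_distrib)
    finally show ?thesis .
  qed
  have grad_eq: "gx K (m a b) = gx K' (m a b) \<and> gy K (m a b) = gy K' (m a b)"
    if e: "closed_segment a b \<in> interior_edges \<Omega> G" and K: "K \<in> G" "closed_segment a b edge_of K"
      and K': "K' \<in> G" "closed_segment a b edge_of K'" for a b K K'
  proof -
    note E = edge_endpoints[OF K] and E' = edge_endpoints[OF K']
    \<comment> \<open>The jumps of the partial derivatives at the midpoint. Vertex values control
      their tangential part, mean normal derivatives their normal part.\<close>
    define u v where "u = gx K (m a b) - gx K' (m a b)" and "v = gy K (m a b) - gy K' (m a b)"
    have "q K b = q K' b" "q K a = q K' a"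
      using vertex_trace_eq[OF w K(1) K'(1)] E E' by (metis trace K(1) K'(1))+
    then have 1: "u * fst (b - a) + v * snd (b - a) = 0"
      using midpoint_rule[of K b a] midpoint_rule[of K' b a] by (simp add: u_def v_def algebra_simps)
    have "edge_mean a b (cell_trace K (\<lambda>x. grad_h G w x \<bullet> unit_normal a b)) =
          edge_mean a b (cell_trace K' (\<lambda>x. grad_h G w x \<bullet> unit_normal a b))"
      using w e K K' unfolding V_hs_R_def by blast
    then have 2: "u * snd (b - a) - v * fst (b - a) = 0"
      using mean_normal[OF K(1) E(6)] mean_normal[OF K'(1) E'(6)] E(5) by (simp add: u_def v_def algebra_simps)
    \<comment> \<open>Lagrange's identity: a plane vector whose components along a nonzero vector
      and along its rotation both vanish is zero.\<close>
    have "(u\<^sup>2 + v\<^sup>2) * ((fst (b - a))\<^sup>2 + (snd (b - a))\<^sup>2) =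
        (u * fst (b - a) + v * snd (b - a))\<^sup>2 + (u * snd (b - a) - v * fst (b - a))\<^sup>2"
      by (simp add: power2_eq_square algebra_simps)
    moreover have "(fst (b - a))\<^sup>2 + (snd (b - a))\<^sup>2 \<noteq> 0"
      using E(5) by (auto simp: sum_power2_eq_zero_iff prod_eq_iff)
    ultimately have "u\<^sup>2 + v\<^sup>2 = 0"
      unfolding 1 2 by auto
    then show ?thesis
      by (simp add: sum_power2_eq_zero_iff u_def v_def)
  qed
  have P1: "(\<lambda>p. fst (curl_h G w p)) \<in> piecewise_P 1 \<Omega> G" "(\<lambda>p. snd (curl_h G w p)) \<in> piecewise_P 1 \<Omega> G"
  proof -
    have "gy K \<in> poly_space 1" for K
      unfolding poly_space_1_iff gy_def by auto
    then show "(\<lambda>p. fst (curl_h G w p)) \<in> piecewise_P 1 \<Omega> G"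
      by (intro piecewise_P_I) (auto simp: curl off)
    have "(\<lambda>p. - gx K p) = (\<lambda>p. - c1 K + (- 2 * c3 K) * fst p + (- c4 K) * snd p)" for K
      by (auto simp: gx_def)
    then have "(\<lambda>p. - gx K p) \<in> poly_space 1" for K
      unfolding poly_space_1_iff by (metis fst_conv snd_conv)
    then show "(\<lambda>p. snd (curl_h G w p)) \<in> piecewise_P 1 \<Omega> G"
      by (intro piecewise_P_I) (auto simp: curl off)
  qed
  show "curl_h G w \<in> V_PS_hn \<Omega> G"
    unfolding V_PS_hn_def V_PS_def comp_def
  proof (intro CollectI conjI allI impI ballI)
    fix a b K K'
    assume e: "closed_segment a b \<in> interior_edges \<Omega> G" and KK': "K \<in> G" "K' \<in> G"
      "closed_segment a b edge_of K \<and> closed_segment a b edge_of K'"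
    then have sub: "closed_segment a b \<subseteq> K" "closed_segment a b \<subseteq> K'"
      using edge_of_imp_subset by auto
    have eq: "gx K (m a b) = gx K' (m a b)" "gy K (m a b) = gy K' (m a b)"
      using grad_eq[OF e, of K K'] KK' by blast+
    have "edge_mean a b (jump K K' (\<lambda>p. fst (curl_h G w p))) = gy K (m a b) - gy K' (m a b)"
      unfolding gy_def m_def fst_conv snd_conv
      by (rule edge_mean_jump) (use KK' sub in \<open>auto simp: curl gy_def\<close>)
    then show "edge_mean a b (jump K K' (\<lambda>p. fst (curl_h G w p))) = 0"
      using eq by simp
    have "edge_mean a b (jump K K' (\<lambda>p. snd (curl_h G w p))) =
        - c1 K + (- 2 * c3 K) * ((fst a + fst b) / 2) + (- c4 K) * ((snd a + snd b) / 2) -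
        (- c1 K' + (- 2 * c3 K') * ((fst a + fst b) / 2) + (- c4 K') * ((snd a + snd b) / 2))"
      by (rule edge_mean_jump) (use KK' sub in \<open>auto simp: curl gx_def\<close>)
    also have "\<dots> = gx K' (m a b) - gx K (m a b)"
      by (simp add: gx_def m_def)
    finally show "edge_mean a b (jump K K' (\<lambda>p. snd (curl_h G w p))) = 0"
      using eq by simp
  next
    fix a b K
    assume e: "closed_segment a b \<in> boundary_edges \<Omega> G" and K: "K \<in> G" "closed_segment a b edge_of K"
    note E = edge_endpoints[OF K]
    have "a \<in> boundary_vertices \<Omega> G" "b \<in> boundary_vertices \<Omega> G"
      using e E by (auto simp: boundary_edges_def boundary_vertices_def)
    then have "q K a = 0" "q K b = 0"
      using w K E trace unfolding V_hs_R_def by auto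
    then show "edge_integral a b (cell_trace K (\<lambda>x. curl_h G w x \<bullet> unit_normal a b)) = 0"
      by (simp add: edge_integral_def mean_curl[OF K(1) E(6)])
  qed (use P1 in auto)
  show "div_h G (curl_h G w) x = 0"
  proof (cases "x \<in> (\<Union>K\<in>G. interior K)")
    case True
    then obtain K where K: "K \<in> G" "x \<in> interior K" by blast
    have "partial_x (\<lambda>p. fst (curl_h G w p)) x = c4 K"
      by (rule partial_x_eq[OF open_interior K(2), of _ "gy K"])
        (auto simp: curl[OF K(1)] gy_def intro!: derivative_eq_intros)
    moreover have "partial_y (\<lambda>p. snd (curl_h G w p)) x = - c4 K"
      by (rule partial_y_eq[OF open_interior K(2), of _ "\<lambda>p. - gx K p"])
        (auto simp: curl[OF K(1)] gx_def intro!: derivative_eq_intros)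
    ultimately show ?thesis
      using K by (simp add: div_h_def cellwise_interior comp_def)
  qed (simp add: div_h_def cellwise_def)
qed

end

lemma continuous_on_clamp_length [continuous_intros]:
  "continuous_on S f \<Longrightarrow> continuous_on S (\<lambda>x. clamp_length a b (f x))"
  unfolding clamp_length_def by (intro continuous_intros)

section \<open>Stream functions of solenoidal Park--Sheen fields\<close>

text \<open>The vanishing divergence is encoded in the shared coefficient \<open>B K\<close>, the
  \<open>x\<close> slope of the first component and minus the \<open>y\<close> slope of the
  second.\<close>

locale solenoidal_field = domain_grid +
  fixes z :: "point \<Rightarrow> point" and A B C D E :: "point set \<Rightarrow> real"
  assumes z_cell: "\<And>K p. K \<in> G \<Longrightarrow> p \<in> interior K \<Longrightarrow>
      z p = (A K + B K * fst p + C K * snd p, D K + E K * fst p - B K * snd p)"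
    and z_space: "z \<in> V_PS_hn \<Omega> G"
begin

text \<open>Defined on the whole plane, so that it can be evaluated at midpoints of edges, which lie
  off the open cells, where \<open>z\<close> itself vanishes.\<close>

definition z1 :: "point set \<Rightarrow> real \<Rightarrow> real \<Rightarrow> real" where
  "z1 K x y = A K + B K * x + C K * y"

definition z2 :: "point set \<Rightarrow> real \<Rightarrow> real \<Rightarrow> real" where
  "z2 K x y = D K + E K * x - B K * y"

abbreviation x_mid :: "point set \<Rightarrow> real" where "x_mid K \<equiv> (x_lo K + x_hi K) / 2"
abbreviation y_mid :: "point set \<Rightarrow> real" where "y_mid K \<equiv> (y_lo K + y_hi K) / 2"

text \<open>The components are affine on both cells, so a mean jump is the difference of the values
  at the midpoint of the edge.\<close>

lemma interior_edge_means:
  assumes e: "closed_segment a b \<in> interior_edges \<Omega> G"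
    and K: "K \<in> G" "closed_segment a b edge_of K" and K': "K' \<in> G" "closed_segment a b edge_of K'"
  shows "z1 K ((fst a + fst b) / 2) ((snd a + snd b) / 2) = z1 K' ((fst a + fst b) / 2) ((snd a + snd b) / 2)"
    and "z2 K ((fst a + fst b) / 2) ((snd a + snd b) / 2) = z2 K' ((fst a + fst b) / 2) ((snd a + snd b) / 2)"
proof -
  have sub: "closed_segment a b \<subseteq> K" "closed_segment a b \<subseteq> K'"
    using K K' edge_of_imp_subset by auto
  have "fst \<circ> z \<in> V_PS \<Omega> G" "snd \<circ> z \<in> V_PS \<Omega> G"
    using z_space by (auto simp: V_PS_hn_def)
  then have "edge_mean a b (jump K K' (fst \<circ> z)) = 0" "edge_mean a b (jump K K' (snd \<circ> z)) = 0"
    using e K K' unfolding V_PS_def by blast+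
  moreover have "edge_mean a b (jump K K' (fst \<circ> z)) =
      z1 K ((fst a + fst b) / 2) ((snd a + snd b) / 2) - z1 K' ((fst a + fst b) / 2) ((snd a + snd b) / 2)"
    unfolding z1_def using K K' sub by (intro edge_mean_jump) (simp_all add: z_cell)
  moreover have "edge_mean a b (jump K K' (snd \<circ> z)) =
      D K + E K * ((fst a + fst b) / 2) + (- B K) * ((snd a + snd b) / 2) -
      (D K' + E K' * ((fst a + fst b) / 2) + (- B K') * ((snd a + snd b) / 2))"
    using K K' sub by (intro edge_mean_jump) (simp_all add: z_cell)
  ultimately show "z1 K ((fst a + fst b) / 2) ((snd a + snd b) / 2) = z1 K' ((fst a + fst b) / 2) ((snd a + snd b) / 2)"
    "z2 K ((fst a + fst b) / 2) ((snd a + snd b) / 2) = z2 K' ((fst a + fst b) / 2) ((snd a + snd b) / 2)"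
    unfolding z2_def by simp_all
qed

text \<open>The flux is the length times the normal component at the midpoint; written in
  coordinates, the length cancels.\<close>

lemma boundary_edge_flux:
  assumes e: "closed_segment a b \<in> boundary_edges \<Omega> G" and K: "K \<in> G" "closed_segment a b edge_of K"
  shows "z1 K ((fst a + fst b) / 2) ((snd a + snd b) / 2) * snd (b - a) =
    z2 K ((fst a + fst b) / 2) ((snd a + snd b) / 2) * fst (b - a)"
proof -
  let ?n = "unit_normal a b"
  note sub = edge_endpoints(5,6)[OF K]
  have "edge_mean a b (cell_trace K (\<lambda>x. z x \<bullet> ?n)) = (A K * fst ?n + D K * snd ?n) +
      (B K * fst ?n + E K * snd ?n) * ((fst a + fst b) / 2) +
      (C K * fst ?n - B K * snd ?n) * ((snd a + snd b) / 2)"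
    using K sub by (intro edge_mean_trace) (simp_all add: z_cell inner_prod_def algebra_simps)
  also have "\<dots> = z1 K ((fst a + fst b) / 2) ((snd a + snd b) / 2) * fst ?n +
      z2 K ((fst a + fst b) / 2) ((snd a + snd b) / 2) * snd ?n"
    by (simp add: z1_def z2_def algebra_simps)
  also have "\<dots> = (z1 K ((fst a + fst b) / 2) ((snd a + snd b) / 2) * snd (b - a) -
    z2 K ((fst a + fst b) / 2) ((snd a + snd b) / 2) * fst (b - a)) / norm (b - a)"
    by (simp add: unit_normal_def diff_divide_distrib right_diff_distrib)
  finally have *: "edge_mean a b (cell_trace K (\<lambda>x. z x \<bullet> ?n)) = \<dots>" .
  have "edge_integral a b (cell_trace K (\<lambda>x. z x \<bullet> ?n)) = 0"
    using z_space e K unfolding V_PS_hn_def by blast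
  then show ?thesis
    using sub(1) unfolding edge_integral_def * by simp
qed

text \<open>A nonzero flux cannot leave through a boundary edge, so the side is shared, and
  continuity of the edge mean hands the flux on to the neighbour. Together with the next three
  lemmas this supplies \<open>right\<close> and \<open>left\<close> of \<open>cell_family\<close> in
  both directions.\<close>

lemma x_hi_edge:
  assumes K: "K \<in> G"
  shows "{x_hi K} \<times> {y_lo K..y_hi K} \<in> boundary_edges \<Omega> G \<Longrightarrow> z1 K (x_hi K) (y_mid K) = 0"
    and "z1 K (x_hi K) (y_mid K) \<noteq> 0 \<Longrightarrow> \<exists>K'\<in>G. x_lo K' = x_hi K \<and> y_lo K' = y_lo K \<and> y_hi K' = y_hi K \<and>
      z1 K' (x_lo K') (y_mid K') = z1 K (x_hi K) (y_mid K)"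
proof -
  have e: "closed_segment (x_hi K, y_lo K) (x_hi K, y_hi K) = {x_hi K} \<times> {y_lo K..y_hi K}"
    using cell_bounds[OF K] by (simp add: closed_segment_vertical closed_segment_eq_real_ivl)
  have eK: "{x_hi K} \<times> {y_lo K..y_hi K} edge_of K"
    using edge_of_cell[OF K] by blast
  show zero: "{x_hi K} \<times> {y_lo K..y_hi K} \<in> boundary_edges \<Omega> G \<Longrightarrow> z1 K (x_hi K) (y_mid K) = 0"
    using boundary_edge_flux[of "(x_hi K, y_lo K)" "(x_hi K, y_hi K)" K] K eK cell_bounds[OF K] by (simp add: e)
  assume "z1 K (x_hi K) (y_mid K) \<noteq> 0"
  then obtain K' where K': "K' \<in> G" "K' \<noteq> K" "{x_hi K} \<times> {y_lo K..y_hi K} edge_of K'"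
    and int: "{x_hi K} \<times> {y_lo K..y_hi K} \<in> interior_edges \<Omega> G"
    using edge_cases[OF K eK] zero by blast
  have "x_lo K' = x_hi K \<and> y_lo K' = y_lo K \<and> y_hi K' = y_hi K"
    using neighbour_x_hi[OF K K'(1)] K' by blast
  moreover have "z1 K (x_hi K) (y_mid K) = z1 K' (x_hi K) (y_mid K)"
    using interior_edge_means(1)[of "(x_hi K, y_lo K)" "(x_hi K, y_hi K)" K K'] K K' eK int by (simp add: e)
  ultimately show "\<exists>K'\<in>G. x_lo K' = x_hi K \<and> y_lo K' = y_lo K \<and> y_hi K' = y_hi K \<and>
      z1 K' (x_lo K') (y_mid K') = z1 K (x_hi K) (y_mid K)"
    using K'(1) by metis
qed

lemma x_lo_edge:
  assumes K: "K \<in> G"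
  shows "{x_lo K} \<times> {y_lo K..y_hi K} \<in> boundary_edges \<Omega> G \<Longrightarrow> z1 K (x_lo K) (y_mid K) = 0"
    and "z1 K (x_lo K) (y_mid K) \<noteq> 0 \<Longrightarrow> \<exists>K'\<in>G. x_hi K' = x_lo K \<and> y_lo K' = y_lo K \<and> y_hi K' = y_hi K \<and>
      z1 K' (x_hi K') (y_mid K') = z1 K (x_lo K) (y_mid K)"
proof -
  have e: "closed_segment (x_lo K, y_lo K) (x_lo K, y_hi K) = {x_lo K} \<times> {y_lo K..y_hi K}"
    using cell_bounds[OF K] by (simp add: closed_segment_vertical closed_segment_eq_real_ivl)
  have eK: "{x_lo K} \<times> {y_lo K..y_hi K} edge_of K"
    using edge_of_cell[OF K] by blast
  show zero: "{x_lo K} \<times> {y_lo K..y_hi K} \<in> boundary_edges \<Omega> G \<Longrightarrow> z1 K (x_lo K) (y_mid K) = 0"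
    using boundary_edge_flux[of "(x_lo K, y_lo K)" "(x_lo K, y_hi K)" K] K eK cell_bounds[OF K] by (simp add: e)
  assume "z1 K (x_lo K) (y_mid K) \<noteq> 0"
  then obtain K' where K': "K' \<in> G" "K' \<noteq> K" "{x_lo K} \<times> {y_lo K..y_hi K} edge_of K'"
    and int: "{x_lo K} \<times> {y_lo K..y_hi K} \<in> interior_edges \<Omega> G"
    using edge_cases[OF K eK] zero by blast
  have "x_hi K' = x_lo K \<and> y_lo K' = y_lo K \<and> y_hi K' = y_hi K"
    using neighbour_x_lo[OF K K'(1)] K' by blast
  moreover have "z1 K (x_lo K) (y_mid K) = z1 K' (x_lo K) (y_mid K)"
    using interior_edge_means(1)[of "(x_lo K, y_lo K)" "(x_lo K, y_hi K)" K K'] K K' eK int by (simp add: e)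
  ultimately show "\<exists>K'\<in>G. x_hi K' = x_lo K \<and> y_lo K' = y_lo K \<and> y_hi K' = y_hi K \<and>
      z1 K' (x_hi K') (y_mid K') = z1 K (x_lo K) (y_mid K)"
    using K'(1) by metis
qed

lemma y_hi_edge:
  assumes K: "K \<in> G"
  shows "{x_lo K..x_hi K} \<times> {y_hi K} \<in> boundary_edges \<Omega> G \<Longrightarrow> z2 K (x_mid K) (y_hi K) = 0"
    and "z2 K (x_mid K) (y_hi K) \<noteq> 0 \<Longrightarrow> \<exists>K'\<in>G. y_lo K' = y_hi K \<and> x_lo K' = x_lo K \<and> x_hi K' = x_hi K \<and>
      z2 K' (x_mid K') (y_lo K') = z2 K (x_mid K) (y_hi K)"
proof -
  have e: "closed_segment (x_lo K, y_hi K) (x_hi K, y_hi K) = {x_lo K..x_hi K} \<times> {y_hi K}"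
    using cell_bounds[OF K] by (simp add: closed_segment_horizontal closed_segment_eq_real_ivl)
  have eK: "{x_lo K..x_hi K} \<times> {y_hi K} edge_of K"
    using edge_of_cell[OF K] by blast
  show zero: "{x_lo K..x_hi K} \<times> {y_hi K} \<in> boundary_edges \<Omega> G \<Longrightarrow> z2 K (x_mid K) (y_hi K) = 0"
    using boundary_edge_flux[of "(x_lo K, y_hi K)" "(x_hi K, y_hi K)" K] K eK cell_bounds[OF K] by (simp add: e)
  assume "z2 K (x_mid K) (y_hi K) \<noteq> 0"
  then obtain K' where K': "K' \<in> G" "K' \<noteq> K" "{x_lo K..x_hi K} \<times> {y_hi K} edge_of K'"
    and int: "{x_lo K..x_hi K} \<times> {y_hi K} \<in> interior_edges \<Omega> G"
    using edge_cases[OF K eK] zero by blast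
  have "y_lo K' = y_hi K \<and> x_lo K' = x_lo K \<and> x_hi K' = x_hi K"
    using neighbour_y_hi[OF K K'(1)] K' by blast
  moreover have "z2 K (x_mid K) (y_hi K) = z2 K' (x_mid K) (y_hi K)"
    using interior_edge_means(2)[of "(x_lo K, y_hi K)" "(x_hi K, y_hi K)" K K'] K K' eK int by (simp add: e)
  ultimately show "\<exists>K'\<in>G. y_lo K' = y_hi K \<and> x_lo K' = x_lo K \<and> x_hi K' = x_hi K \<and>
      z2 K' (x_mid K') (y_lo K') = z2 K (x_mid K) (y_hi K)"
    using K'(1) by metis
qed

lemma y_lo_edge:
  assumes K: "K \<in> G"
  shows "{x_lo K..x_hi K} \<times> {y_lo K} \<in> boundary_edges \<Omega> G \<Longrightarrow> z2 K (x_mid K) (y_lo K) = 0"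
    and "z2 K (x_mid K) (y_lo K) \<noteq> 0 \<Longrightarrow> \<exists>K'\<in>G. y_hi K' = y_lo K \<and> x_lo K' = x_lo K \<and> x_hi K' = x_hi K \<and>
      z2 K' (x_mid K') (y_hi K') = z2 K (x_mid K) (y_lo K)"
proof -
  have e: "closed_segment (x_lo K, y_lo K) (x_hi K, y_lo K) = {x_lo K..x_hi K} \<times> {y_lo K}"
    using cell_bounds[OF K] by (simp add: closed_segment_horizontal closed_segment_eq_real_ivl)
  have eK: "{x_lo K..x_hi K} \<times> {y_lo K} edge_of K"
    using edge_of_cell[OF K] by blast
  show zero: "{x_lo K..x_hi K} \<times> {y_lo K} \<in> boundary_edges \<Omega> G \<Longrightarrow> z2 K (x_mid K) (y_lo K) = 0"
    using boundary_edge_flux[of "(x_lo K, y_lo K)" "(x_hi K, y_lo K)" K] K eK cell_bounds[OF K] by (simp add: e)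
  assume "z2 K (x_mid K) (y_lo K) \<noteq> 0"
  then obtain K' where K': "K' \<in> G" "K' \<noteq> K" "{x_lo K..x_hi K} \<times> {y_lo K} edge_of K'"
    and int: "{x_lo K..x_hi K} \<times> {y_lo K} \<in> interior_edges \<Omega> G"
    using edge_cases[OF K eK] zero by blast
  have "y_hi K' = y_lo K \<and> x_lo K' = x_lo K \<and> x_hi K' = x_hi K"
    using neighbour_y_lo[OF K K'(1)] K' by blast
  moreover have "z2 K (x_mid K) (y_lo K) = z2 K' (x_mid K) (y_lo K)"
    using interior_edge_means(2)[of "(x_lo K, y_lo K)" "(x_hi K, y_lo K)" K K'] K K' eK int by (simp add: e)
  ultimately show "\<exists>K'\<in>G. y_hi K' = y_lo K \<and> x_lo K' = x_lo K \<and> x_hi K' = x_hi K \<and>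
      z2 K' (x_mid K') (y_hi K') = z2 K (x_mid K) (y_lo K)"
    using K'(1) by metis
qed

text \<open>Fluxes through vertical sides. Between the midpoints of these sides the first component
  grows by \<open>B K\<close> times the width, which is \<open>slope\<close>.\<close>

sublocale vert: cell_family G x_lo x_hi y_lo y_hi B
  "\<lambda>K. z1 K (x_lo K) (y_mid K)" "\<lambda>K. z1 K (x_hi K) (y_mid K)"
proof
  show "x_hi K \<le> x_lo K' \<or> x_hi K' \<le> x_lo K \<or> y_hi K \<le> y_lo K' \<or> y_hi K' \<le> y_lo K"
    if "K \<in> G" "K' \<in> G" "K \<noteq> K'" for K K'
    by (rule cells_separated[OF that])
qed (use finite_grid cell_bounds x_hi_edge x_lo_edge in \<open>simp_all add: z1_def right_diff_distrib\<close>)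

text \<open>The same with the axes exchanged. The sign of \<open>z2\<close> is reversed because its
  \<open>y\<close> slope is \<open>- B K\<close>, so that both families have the density
  \<open>B\<close>.\<close>

sublocale hor: cell_family G y_lo y_hi x_lo x_hi B
  "\<lambda>K. - z2 K (x_mid K) (y_lo K)" "\<lambda>K. - z2 K (x_mid K) (y_hi K)"
proof
  show "y_hi K \<le> y_lo K' \<or> y_hi K' \<le> y_lo K \<or> x_hi K \<le> x_lo K' \<or> x_hi K' \<le> x_lo K"
    if "K \<in> G" "K' \<in> G" "K \<noteq> K'" for K K'
    using cells_separated[OF that] by blast
  show "\<exists>K'\<in>G. y_lo K' = y_hi K \<and> x_lo K' = x_lo K \<and> x_hi K' = x_hi K \<and>
      - z2 K' (x_mid K') (y_lo K') = - z2 K (x_mid K) (y_hi K)"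
    if "K \<in> G" "- z2 K (x_mid K) (y_hi K) \<noteq> 0" for K
    using y_hi_edge(2)[OF that(1)] that(2) by simp
  show "\<exists>K'\<in>G. y_hi K' = y_lo K \<and> x_lo K' = x_lo K \<and> x_hi K' = x_hi K \<and>
      - z2 K' (x_mid K') (y_hi K') = - z2 K (x_mid K) (y_lo K)"
    if "K \<in> G" "- z2 K (x_mid K) (y_lo K) \<noteq> 0" for K
    using y_lo_edge(2)[OF that(1)] that(2) by simp
qed (use finite_grid cell_bounds in \<open>simp_all add: z2_def right_diff_distrib\<close>)

definition \<Psi> :: "point \<Rightarrow> real" where
  "\<Psi> p = vert.potential (fst p) (snd p)"

text \<open>The two families have the same rectangles and the same density, so the sums agree term
  by term. Hence one function has the prescribed increments along vertical and along horizontal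
  edges.\<close>

lemma hor_potential: "hor.potential y x = \<Psi> (x, y)"
  unfolding \<Psi>_def vert.potential_def hor.potential_def by (simp add: mult_ac)

lemma continuous_on_\<Psi>: "continuous_on S \<Psi>"
  unfolding \<Psi>_def vert.potential_def by (intro continuous_intros)

lemma \<Psi>_edges:
  assumes K: "K \<in> G"
  shows "\<lbrakk>y_lo K \<le> y; y \<le> y_hi K\<rbrakk> \<Longrightarrow>
      \<Psi> (x_lo K, y) - \<Psi> (x_lo K, y_lo K) = (y - y_lo K) * z1 K (x_lo K) (y_mid K)"
    and "\<lbrakk>y_lo K \<le> y; y \<le> y_hi K\<rbrakk> \<Longrightarrow>
      \<Psi> (x_hi K, y) - \<Psi> (x_hi K, y_lo K) = (y - y_lo K) * z1 K (x_hi K) (y_mid K)"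
    and "\<lbrakk>x_lo K \<le> x; x \<le> x_hi K\<rbrakk> \<Longrightarrow>
      \<Psi> (x, y_lo K) - \<Psi> (x_lo K, y_lo K) = (x - x_lo K) * - z2 K (x_mid K) (y_lo K)"
    and "\<lbrakk>x_lo K \<le> x; x \<le> x_hi K\<rbrakk> \<Longrightarrow>
      \<Psi> (x, y_hi K) - \<Psi> (x_lo K, y_hi K) = (x - x_lo K) * - z2 K (x_mid K) (y_hi K)"
  using vert.potential_diff[OF K, of y] hor.potential_diff[OF K, of x]
  by (simp_all add: hor_potential) (simp_all add: \<Psi>_def)

text \<open>Up to sign, the slope of \<open>\<Psi>\<close> along an edge is the mean flux through
  it, which is zero on the boundary.\<close>

lemma \<Psi>_constant_on_boundary_edge:
  assumes "e \<in> boundary_edges \<Omega> G"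
  shows "\<exists>c. \<forall>p\<in>e. \<Psi> p = c"
proof -
  obtain K where K: "K \<in> G" "e edge_of K"
    using assms by (auto simp: boundary_edges_def edges_def)
  show ?thesis
    using K(2) unfolding edge_of_cell[OF K(1)]
  proof (elim disjE)
    assume e: "e = {x_lo K} \<times> {y_lo K..y_hi K}"
    then have "z1 K (x_lo K) (y_mid K) = 0"
      using x_lo_edge(1)[OF K(1)] assms by simp
    then have "\<Psi> (x_lo K, y) = \<Psi> (x_lo K, y_lo K)" if "y_lo K \<le> y" "y \<le> y_hi K" for y
      using \<Psi>_edges(1)[OF K(1) that] by simp
    then obtain c where "\<And>y. \<lbrakk>y_lo K \<le> y; y \<le> y_hi K\<rbrakk> \<Longrightarrow> \<Psi> (x_lo K, y) = c"
      by blast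
    then show ?thesis
      unfolding e by (intro exI[of _ c]) auto
  next
    assume e: "e = {x_hi K} \<times> {y_lo K..y_hi K}"
    then have "z1 K (x_hi K) (y_mid K) = 0"
      using x_hi_edge(1)[OF K(1)] assms by simp
    then have "\<Psi> (x_hi K, y) = \<Psi> (x_hi K, y_lo K)" if "y_lo K \<le> y" "y \<le> y_hi K" for y
      using \<Psi>_edges(2)[OF K(1) that] by simp
    then obtain c where "\<And>y. \<lbrakk>y_lo K \<le> y; y \<le> y_hi K\<rbrakk> \<Longrightarrow> \<Psi> (x_hi K, y) = c"
      by blast
    then show ?thesis
      unfolding e by (intro exI[of _ c]) auto
  next
    assume e: "e = {x_lo K..x_hi K} \<times> {y_lo K}"
    then have "z2 K (x_mid K) (y_lo K) = 0"
      using y_lo_edge(1)[OF K(1)] assms by simp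
    then have "\<Psi> (x, y_lo K) = \<Psi> (x_lo K, y_lo K)" if "x_lo K \<le> x" "x \<le> x_hi K" for x
      using \<Psi>_edges(3)[OF K(1) that] by simp
    then obtain c where "\<And>x. \<lbrakk>x_lo K \<le> x; x \<le> x_hi K\<rbrakk> \<Longrightarrow> \<Psi> (x, y_lo K) = c"
      by blast
    then show ?thesis
      unfolding e by (intro exI[of _ c]) auto
  next
    assume e: "e = {x_lo K..x_hi K} \<times> {y_hi K}"
    then have "z2 K (x_mid K) (y_hi K) = 0"
      using y_hi_edge(1)[OF K(1)] assms by simp
    then have "\<Psi> (x, y_hi K) = \<Psi> (x_lo K, y_hi K)" if "x_lo K \<le> x" "x \<le> x_hi K" for x
      using \<Psi>_edges(4)[OF K(1) that] by simp
    then obtain c where "\<And>x. \<lbrakk>x_lo K \<le> x; x \<le> x_hi K\<rbrakk> \<Longrightarrow> \<Psi> (x, y_hi K) = c"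
      by blast
    then show ?thesis
      unfolding e by (intro exI[of _ c]) auto
  qed
qed

text \<open>Finitely many boundary edges cover the frontier, so \<open>\<Psi>\<close> has finite
  range there, and a continuous function with finite range on a connected set is constant.\<close>

lemma \<Psi>_constant_on_frontier:
  assumes "simply_connected \<Omega>"
  shows "\<exists>c. \<forall>p\<in>frontier \<Omega>. \<Psi> p = c"
proof -
  have "finite (boundary_edges \<Omega> G)"
    using finite_edges by (auto simp: boundary_edges_def)
  moreover obtain c where c: "\<forall>e\<in>boundary_edges \<Omega> G. \<forall>p\<in>e. \<Psi> p = c e"
    using \<Psi>_constant_on_boundary_edge by metis
  have "\<Psi> ` frontier \<Omega> \<subseteq> c ` boundary_edges \<Omega> G"
    using frontier_subset_boundary_edges c by blast
  ultimately have "finite (\<Psi> ` frontier \<Omega>)"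
    using finite_surj by blast
  then have "\<Psi> constant_on frontier \<Omega>"
    using connected_frontier_simply_connected[OF open_domain bounded_domain assms]
    by (intro continuous_finite_range_constant continuous_on_\<Psi>)
  then show ?thesis
    by (simp add: constant_on_def)
qed

text \<open>A quadratic potential on a cell has the increments of \<open>\<Psi>\<close> between
  adjacent corners, so adjusting it at one corner gives agreement at all four. Mean normal
  derivatives match because the edge means of \<open>z\<close> do.\<close>

lemma stream_function_exists:
  assumes "simply_connected \<Omega>"
  shows "\<exists>w\<in>V_hs_R \<Omega> G. curl_h G w = z"
proof -
  obtain \<kappa> where \<kappa>: "\<And>p. p \<in> frontier \<Omega> \<Longrightarrow> \<Psi> p = \<kappa>"
    using \<Psi>_constant_on_frontier[OF assms] by blast
  \<comment> \<open>Its gradient is \<open>(- z2 K, z1 K)\<close>. The coefficient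
    \<open>B K\<close> serves both mixed derivatives because the divergence vanishes.\<close>
  define P where "P K = quadratic 0 (- D K) (A K) (- E K / 2) (B K) (C K / 2)" for K
  \<comment> \<open>This constant makes \<open>q K\<close> equal to \<open>\<Psi> - \<kappa>\<close>
    at the lower left corner; subtracting \<open>\<kappa>\<close> yields zero values on the
    boundary.\<close>
  define shift where "shift K = \<Psi> (x_lo K, y_lo K) - \<kappa> - P K (x_lo K, y_lo K)" for K
  define q where "q K = quadratic (shift K) (- D K) (A K) (- E K / 2) (B K) (C K / 2)" for K
  have qP: "q K p = P K p + shift K" for K p
    by (simp add: q_def P_def quadratic_def)
  \<comment> \<open>Open cells are disjoint, so at most one index contributes, and \<open>w\<close>
    is 0 off the open cells as \<open>piecewise_P\<close> demands.\<close>
  define w where "w p = (\<Sum>K\<in>G. if p \<in> interior K then q K p else 0)" for p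
  have w_cell: "w p = q K p" if "K \<in> G" "p \<in> interior K" for K p
  proof -
    have "w p = (\<Sum>K\<in>{K}. if p \<in> interior K then q K p else 0)"
      unfolding w_def using finite_grid interiors_disjoint that by (intro sum.mono_neutral_right) auto
    then show ?thesis using that by simp
  qed
  have w_off: "w p = 0" if "p \<notin> (\<Union>K\<in>G. interior K)" for p
    using that unfolding w_def by (intro sum.neutral) auto
  have trace: "cell_trace K w p = q K p" if "K \<in> G" "p \<in> K" for K p
    using that by (auto simp: q_def w_cell intro!: cell_trace_eq isCont_quadratic)
  have corner: "q K p = \<Psi> p - \<kappa>" if "K \<in> G" "p \<in> {x_lo K, x_hi K} \<times> {y_lo K, y_hi K}" for K p
  proof -
    have b: "x_lo K \<le> x_hi K" "y_lo K \<le> y_hi K"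
      using cell_bounds[OF that(1)] by auto
    \<comment> \<open>The left, right and bottom sides already connect all four corners.\<close>
    have "q K (x_lo K, y_hi K) - q K (x_lo K, y_lo K) = (y_hi K - y_lo K) * z1 K (x_lo K) (y_mid K)"
      "q K (x_hi K, y_hi K) - q K (x_hi K, y_lo K) = (y_hi K - y_lo K) * z1 K (x_hi K) (y_mid K)"
      "q K (x_hi K, y_lo K) - q K (x_lo K, y_lo K) = (x_hi K - x_lo K) * - z2 K (x_mid K) (y_lo K)"
      by (simp_all add: q_def quadratic_midpoint_rule z1_def z2_def field_simps)
    moreover have "q K (x_lo K, y_lo K) = \<Psi> (x_lo K, y_lo K) - \<kappa>"
      by (simp add: qP shift_def)
    ultimately show ?thesis
      using that(2) \<Psi>_edges(1,2)[OF that(1) b(2) order_refl] \<Psi>_edges(3)[OF that(1) b(1) order_refl] by auto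
  qed
  have vertex_trace: "cell_trace K w p = \<Psi> p - \<kappa>" if "K \<in> G" "p \<in> K" "p \<in> vertices G" for K p
    using trace[OF that(1,2)] corner[OF that(1) vertex_corner[OF that(3,1,2)]] by simp
  have partial: "partial_x w p = - z2 K (fst p) (snd p)" "partial_y w p = z1 K (fst p) (snd p)"
    if "K \<in> G" "p \<in> interior K" for K p
    using partial_quadratic[OF open_interior that(2) w_cell[OF that(1), unfolded q_def]]
    by (simp_all add: z1_def z2_def)
  \<comment> \<open>The curl has to equal \<open>z\<close> as a function on the plane, including the
    points off the open cells.\<close>
  have z_off: "z p = 0" if "p \<notin> (\<Union>K\<in>G. interior K)" for p
  proof -
    have "(fst \<circ> z) p = 0" "(snd \<circ> z) p = 0"
      using z_space that unfolding V_PS_hn_def V_PS_def piecewise_P_def by blast+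
    then show ?thesis by (simp add: prod_eq_iff)
  qed
  have "curl_h G w p = z p" for p
  proof (cases "p \<in> (\<Union>K\<in>G. interior K)")
    case True
    then obtain K where K: "K \<in> G" "p \<in> interior K" by blast
    have "curl_h G w p = (partial_y w p, - partial_x w p)"
      unfolding curl_h_def by (rule cellwise_interior[OF K])
    then show ?thesis
      unfolding partial[OF K] z_cell[OF K] z1_def z2_def by simp
  qed (simp add: curl_h_def cellwise_def z_off)
  then have curl: "curl_h G w = z" by blast
  have grad: "grad_h G w p = (- z2 K (fst p) (snd p), z1 K (fst p) (snd p))" if "K \<in> G" "p \<in> interior K" for K p
    unfolding grad_h_def by (simp only: cellwise_interior[OF that] partial[OF that])
  have mean_normal: "edge_mean a b (cell_trace K (\<lambda>x. grad_h G w x \<bullet> unit_normal a b)) =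
      - z2 K ((fst a + fst b) / 2) ((snd a + snd b) / 2) * fst (unit_normal a b) +
      z1 K ((fst a + fst b) / 2) ((snd a + snd b) / 2) * snd (unit_normal a b)"
    if "K \<in> G" "closed_segment a b \<subseteq> K" for K a b
  proof -
    let ?n = "unit_normal a b"
    have "edge_mean a b (cell_trace K (\<lambda>x. grad_h G w x \<bullet> ?n)) =
      (A K * snd ?n - D K * fst ?n) + (B K * snd ?n - E K * fst ?n) * ((fst a + fst b) / 2) +
      (C K * snd ?n + B K * fst ?n) * ((snd a + snd b) / 2)"
      using that by (intro edge_mean_trace)
        (simp_all add: grad[OF that(1)] z1_def z2_def inner_prod_def algebra_simps)
    then show ?thesis
      by (simp add: z1_def z2_def algebra_simps)
  qed
  have "w \<in> V_hs_R \<Omega> G"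
    unfolding V_hs_R_def
  proof (intro CollectI conjI allI impI ballI)
    have "q K \<in> poly_space 2" for K
      unfolding poly_space_2_iff q_def by blast
    then show "w \<in> piecewise_P 2 \<Omega> G"
      by (intro piecewise_P_I) (auto simp: w_cell w_off)
  next
    fix p K K' assume "p \<in> interior_vertices \<Omega> G" "K \<in> G" "K' \<in> G" "p \<in> K \<and> p \<in> K'"
    then show "cell_trace K w p = cell_trace K' w p"
      by (simp add: vertex_trace interior_vertices_def)
  next
    fix a b K K'
    assume e: "closed_segment a b \<in> interior_edges \<Omega> G" and KK': "K \<in> G" "K' \<in> G"
      "closed_segment a b edge_of K \<and> closed_segment a b edge_of K'"
    then have sub: "closed_segment a b \<subseteq> K" "closed_segment a b \<subseteq> K'"
      using edge_of_imp_subset by auto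
    show "edge_mean a b (cell_trace K (\<lambda>x. grad_h G w x \<bullet> unit_normal a b)) =
      edge_mean a b (cell_trace K' (\<lambda>x. grad_h G w x \<bullet> unit_normal a b))"
      unfolding mean_normal[OF KK'(1) sub(1)] mean_normal[OF KK'(2) sub(2)]
      using interior_edge_means[OF e, of K K'] KK' by simp
  next
    fix p K assume "p \<in> boundary_vertices \<Omega> G" "K \<in> G" "p \<in> K"
    then show "cell_trace K w p = 0"
      by (simp add: vertex_trace boundary_vertices_def \<kappa>)
  qed
  with curl show ?thesis by blast
qed

end

section \<open>Coefficients of a solenoidal field and equality of the two spaces\<close>

context domain_grid
begin

text \<open>The divergence of an affine field is constant on an open cell, so evaluating it at one
  interior point relates the two slopes.\<close>

lemma solenoidal_coefficients:
  assumes z: "z \<in> V_PS_hn \<Omega> G" and div: "\<And>x. div_h G z x = 0" and K: "K \<in> G"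
  shows "\<exists>A B C D E. \<forall>p\<in>interior K. z p = (A + B * fst p + C * snd p, D + E * fst p - B * snd p)"
proof -
  have "\<forall>K\<in>G. \<exists>p\<in>poly_space 1. \<forall>x\<in>interior K. (fst \<circ> z) x = p x"
    "\<forall>K\<in>G. \<exists>p\<in>poly_space 1. \<forall>x\<in>interior K. (snd \<circ> z) x = p x"
    using z by (simp_all add: V_PS_hn_def V_PS_def piecewise_P_def)
  then obtain p1 p2 where p: "p1 \<in> poly_space 1" "\<forall>x\<in>interior K. (fst \<circ> z) x = p1 x"
    "p2 \<in> poly_space 1" "\<forall>x\<in>interior K. (snd \<circ> z) x = p2 x"
    using K by blast
  obtain A B C where 1: "\<forall>x y. p1 (x, y) = A + B * x + C * y"
    using p(1) unfolding poly_space_1_iff by blast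
  obtain D E F where 2: "\<forall>x y. p2 (x, y) = D + E * x + F * y"
    using p(3) unfolding poly_space_1_iff by blast
  have z_eq: "fst (z q) = A + B * fst q + C * snd q" "snd (z q) = D + E * fst q + F * snd q"
    if "q \<in> interior K" for q
    using p(2,4) that 1 2 by (metis comp_apply prod.collapse)+
  have "interior K \<noteq> {}"
    using cell_bounds(1,2)[OF K] unfolding interior_cell[OF K] by simp
  then obtain q where q: "q \<in> interior K" by blast
  have "partial_x (fst \<circ> z) q = B"
    by (rule partial_x_eq[OF open_interior q, of _ "\<lambda>p. A + B * fst p + C * snd p"])
      (auto simp: z_eq intro!: derivative_eq_intros)
  moreover have "partial_y (snd \<circ> z) q = F"
    by (rule partial_y_eq[OF open_interior q, of _ "\<lambda>p. D + E * fst p + F * snd p"])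
      (auto simp: z_eq intro!: derivative_eq_intros)
  ultimately have "F = - B"
    using div[of q] by (simp add: div_h_def cellwise_interior[OF K q])
  then have "\<forall>p\<in>interior K. z p = (A + B * fst p + C * snd p, D + E * fst p - B * snd p)"
    using z_eq by (simp add: prod_eq_iff)
  then show ?thesis
    by (intro exI)
qed

end

theorem lemma4p7:
  fixes \<Omega> :: "(real \<times> real) set" and G :: "(real \<times> real) set set"
  assumes "polygonal_domain \<Omega>"
    and "simply_connected \<Omega>"
    and "rectangular_grid G \<Omega>"
  shows "curl_h G ` V_hs_R \<Omega> G = {z \<in> V_PS_hn \<Omega> G. \<forall>x. div_h G z x = 0}"
proof -
  interpret domain_grid \<Omega> G
    using assms by unfold_locales
  show ?thesis
  proof (intro equalityI subsetI)
    fix z assume "z \<in> curl_h G ` V_hs_R \<Omega> G"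
    then show "z \<in> {z \<in> V_PS_hn \<Omega> G. \<forall>x. div_h G z x = 0}"
      using curl_h_in_V_PS_hn by blast
  next
    fix z assume "z \<in> {z \<in> V_PS_hn \<Omega> G. \<forall>x. div_h G z x = 0}"
    then have z: "z \<in> V_PS_hn \<Omega> G" "\<And>x. div_h G z x = 0"
      by auto
    \<comment> \<open>Membership in \<open>G\<close> is again kept inside the existential, so that
      choice gives the coefficient functions of the locale.\<close>
    have "\<forall>K. \<exists>A B C D E. K \<in> G \<longrightarrow>
        (\<forall>p\<in>interior K. z p = (A + B * fst p + C * snd p, D + E * fst p - B * snd p))"
      using solenoidal_coefficients[OF z] by blast
    then obtain A B C D E where "\<forall>K. K \<in> G \<longrightarrow> (\<forall>p\<in>interior K.
        z p = (A K + B K * fst p + C K * snd p, D K + E K * fst p - B K * snd p))"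
      unfolding choice_iff by (elim exE)
    then interpret solenoidal_field \<Omega> G z A B C D E
      using z(1) by unfold_locales blast+
    show "z \<in> curl_h G ` V_hs_R \<Omega> G"
      using stream_function_exists[OF assms(2)] by blast
  qed
qed

end
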